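(* The inference rules of $\mathcal{HSP}$ are satisfiability-preserving with respect to $\models_{\mathfrak{B}}$: for every $\mathcal{HSP}$ inference with premise set $N$ and conclusion set $N'$ (for an $\mathcal{HSP}_{\mathrm{Base}}$ inference with premises in $N$ and conclusion $C$, $N'=N\cup\{C\}$; for a Define inference, $N$ and $N'$ are the premise and conclusion sets of the rule), $N\models_{\mathfrak{B}}\Box$ if and only if $N'\models_{\mathfrak{B}}\Box$. Moreover, $N'\models_{\mathfrak{B}} N$.
   Context: Many-sorted first-order logic with equality as the only predicate; clauses are finite multisets of literals; $\Box$ is the empty clause. Only term-generated interpretations serve as models; they satisfy a clause iff they satisfy all its ground instances. Hierarchic setting: BG specification $(\Sigma_B,\mathfrak{B})$, $\mathfrak{B}$ a class of term-generated $\Sigma_B$-interpretations closed under isomorphism; $\Sigma_B$ may contain domain elements (constants interpreted pairwise differently) and parameters (BG constants that may be interpreted freely by members of $\mathfrak{B}$ sharing carriers and the interpretation of non-parameter symbols). Full signature $\Sigma\supseteq\Sigma_B$; other symbols are foreground (FG); an FG operator whose result sort is a BG sort is a BG-sorted FG operator. BG-sorted variables are "abstraction" or "ordinary"; FG variables are ordinary. BG terms use only $\Sigma_B$ and BG variables; pure = no ordinary variables; other terms are FG terms. $N\models_{\mathfrak{B}}N'$ iff every model of $N$ whose restriction to $\Sigma_B$ lies in $\mathfrak{B}$ is a model of $N'$. Simple substitutions map abstraction variables to pure BG terms; $\mathrm{sgi}$, $\mathrm{GndTh}(\mathfrak{B})$ as usual (simple ground instances; ground $\Sigma_B$-formulas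 valid in $\mathfrak{B}$). Weak abstraction: a BG term $q$ is a target term in $C$ if it is neither a domain element nor a variable and $C$ contains $f(s_1,\dots,q,\dots,s_n)$ with $f$ an FG operator or some other $s_i$ an FG or impure BG term; $\mathrm{abstr}(C)$ replaces exhaustively $C[q]$ by $C[X]\lor X\not\approx q$ (fresh abstraction variable, $q$ pure) or $C[y]\lor y\not\approx q$ (fresh ordinary variable, $q$ impure). $\mathcal{HSP}_{\mathrm{Base}}$ (on weakly abstracted premises, with a hierarchic reduction ordering $\succ$ and a selection function): Equality resolution $s\not\approx t\lor C\vdash\mathrm{abstr}(C\sigma)$; Negative superposition $l\approx r\lor C,\ s[u]\not\approx t\lor D\vdash\mathrm{abstr}((s[r]\not\approx t\lor C\lor D)\sigma)$; Positive superposition $l\approx r\lor C,\ s[u]\approx t\lor D\vdash\mathrm{abstr}((s[r]\approx t\lor C\lor D)\sigma)$; Equality factoring $s\approx t\lor l\approx r\lor C\vdash\mathrm{abstr}((l\approx r\lor t\not\approx r\lor C)\sigma)$, where in each case $\sigma$ is a simple mgu of the two unified terms, subject to ordering and selection side conditions; Close: from BG clauses $C_1,\dots,C_n$ such that no member of $\mathfrak{B}$ is a model of $\{C_1,\dots,C_n\}$, infer $\Box$. Unabstraction: $\mathrm{unabstr}(C)$ is obtained by repeatedly replacing $C\lor\zeta\not\approx t$ by $C[\zeta\mapsto t]$ whenever $t=\zeta$ or $\zeta\notin\mathrm{vars}(t)$; if $t[\zeta_1,\dots,\zeta_n]$ is a term in $C$ and $\zeta_i$ is finally instantiated to $t_i$,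 $t[t_1,\dots,t_n]$ is its unabstracted version. Redundancy: $\mathcal{R}^F_{Cl}(M)$ (for ground $M$) = clauses entailed by finitely many smaller clauses of $M$; $\mathcal{R}^H_{Cl}(N)$ = weakly abstracted $C$ with $\mathrm{sgi}(C)\subseteq\mathcal{R}^F_{Cl}(\mathrm{sgi}(N)\cup\mathrm{GndTh}(\mathfrak{B}))\cup\mathrm{GndTh}(\mathfrak{B})$. $\mathcal{HSP}$ = $\mathcal{HSP}_{\mathrm{Base}}$ plus Define: from $N\cup\{L[t[\zeta_1,\dots,\zeta_n]]\lor D\}$ (weakly abstracted) derive $N\cup\mathrm{abstr}(\{t[t_1,\dots,t_n]\approx\alpha,\ L[\alpha]\lor D\})$ where (i) $t[\zeta_1,\dots,\zeta_n]$ is a BG-sorted non-variable term with top-level FG operator no proper subterm of which is such a term, (ii) $t[t_1,\dots,t_n]$ is the unabstracted version of $t[\zeta_1,\dots,\zeta_n]$ w.r.t. the premise clause, (iii) $t[t_1,\dots,t_n]$ is ground, (iv) $\alpha=\alpha_{t[t_1,\dots,t_n]}$ is a parameter uniquely determined by $t[t_1,\dots,t_n]$, and (v) the premise clause belongs to $\mathcal{R}^H_{Cl}$ of the conclusion set.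
   Formalization: For Define, the parameter α must be reserved for the term t: either α does not occur in the premise set, or the abstracted definition t ≈ α is already in it; otherwise the claim fails, e.g. for premises α≈0, f(0)≈1, g(f(0))≈1 with α naming f(0). *)

theory Defs
  imports "HOL-Library.Multiset" "HOL-Library.Uprod"
begin

section \<open>Many-sorted syntax\<close>

text \<open>
  Every variable carries its sort, and for every sort there are countably many variables of
  each kind.  Abstraction variables of a foreground sort are excluded by the well-formedness of
  terms below.  Foreground variables are ordinary.
\<close>

datatype 's var =
  is_abstr_var: AbstrVar nat (var_sort: 's)
| OrdVar nat (var_sort: 's)

datatype ('f, 's) trm = Var "'s var" | Fun 'f "('f, 's) trm list"

record ('f, 's) sig =
  sorts :: "'s set"
  ops :: "'f set"
  arg_sorts :: "'f \<Rightarrow> 's list"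
  res_sort :: "'f \<Rightarrow> 's"

definition wf_sig :: "('f, 's) sig \<Rightarrow> bool" where
  "wf_sig S \<longleftrightarrow> (\<forall>f\<in>ops S. set (arg_sorts S f) \<subseteq> sorts S \<and> res_sort S f \<in> sorts S)"

fun trm_sort :: "('f, 's) sig \<Rightarrow> ('f, 's) trm \<Rightarrow> 's" where
  "trm_sort S (Var x) = var_sort x"
| "trm_sort S (Fun f ts) = res_sort S f"

fun well_sorted :: "('f, 's) sig \<Rightarrow> ('f, 's) trm \<Rightarrow> bool" where
  "well_sorted S (Var x) \<longleftrightarrow> var_sort x \<in> sorts S"
| "well_sorted S (Fun f ts) \<longleftrightarrow>
    f \<in> ops S \<and> map (trm_sort S) ts = arg_sorts S f \<and> (\<forall>t\<in>set ts. well_sorted S t)"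

fun vars_trm :: "('f, 's) trm \<Rightarrow> 's var set" where
  "vars_trm (Var x) = {x}"
| "vars_trm (Fun f ts) = (\<Union>t\<in>set ts. vars_trm t)"

fun ops_trm :: "('f, 's) trm \<Rightarrow> 'f set" where
  "ops_trm (Var x) = {}"
| "ops_trm (Fun f ts) = insert f (\<Union>t\<in>set ts. ops_trm t)"

definition gnd_trm :: "('f, 's) sig \<Rightarrow> ('f, 's) trm \<Rightarrow> bool" where
  "gnd_trm S t \<longleftrightarrow> well_sorted S t \<and> vars_trm t = {}"

type_synonym ('f, 's) subst = "'s var \<Rightarrow> ('f, 's) trm"

fun subst_trm :: "('f, 's) trm \<Rightarrow> ('f, 's) subst \<Rightarrow> ('f, 's) trm" (infixl "\<cdot>" 67) where
  "Var x \<cdot> \<sigma> = \<sigma> x"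
| "Fun f ts \<cdot> \<sigma> = Fun f (map (\<lambda>t. t \<cdot> \<sigma>) ts)"

definition comp_subst :: "('f, 's) subst \<Rightarrow> ('f, 's) subst \<Rightarrow> ('f, 's) subst" (infixl "\<odot>" 75) where
  "\<sigma> \<odot> \<tau> = (\<lambda>x. \<sigma> x \<cdot> \<tau>)"

datatype ('f, 's) ctxt = Hole | More 'f "('f, 's) trm list" "('f, 's) ctxt" "('f, 's) trm list"

fun apply_ctxt :: "('f, 's) ctxt \<Rightarrow> ('f, 's) trm \<Rightarrow> ('f, 's) trm" ("_\<langle>_\<rangle>" [1000, 0] 1000) where
  "Hole\<langle>t\<rangle> = t"
| "(More f ss c ts)\<langle>t\<rangle> = Fun f (ss @ c\<langle>t\<rangle> # ts)"

text \<open>Equations are unordered pairs, so \<open>s \<approx> t\<close> and \<open>t \<approx> s\<close> are identified.\<close>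

datatype 'a lit = is_pos: Pos "'a uprod" | Neg "'a uprod"

abbreviation eq_lit :: "'a \<Rightarrow> 'a \<Rightarrow> 'a lit" (infix "\<approx>" 55) where
  "s \<approx> t \<equiv> Pos (Upair s t)"

abbreviation neq_lit :: "'a \<Rightarrow> 'a \<Rightarrow> 'a lit" (infix "!\<approx>" 55) where
  "s !\<approx> t \<equiv> Neg (Upair s t)"

type_synonym ('f, 's) clause = "('f, 's) trm lit multiset"

definition vars_cls :: "('f, 's) clause \<Rightarrow> 's var set" where
  "vars_cls C = (\<Union>L\<in>set_mset C. \<Union>t\<in>set_lit L. vars_trm t)"

definition ops_cls :: "('f, 's) clause \<Rightarrow> 'f set" where
  "ops_cls C = (\<Union>L\<in>set_mset C. \<Union>t\<in>set_lit L. ops_trm t)"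

definition subst_lit :: "('f, 's) trm lit \<Rightarrow> ('f, 's) subst \<Rightarrow> ('f, 's) trm lit" (infixl "\<cdot>l" 67) where
  "L \<cdot>l \<sigma> = map_lit (\<lambda>t. t \<cdot> \<sigma>) L"

definition subst_cls :: "('f, 's) clause \<Rightarrow> ('f, 's) subst \<Rightarrow> ('f, 's) clause" (infixl "\<cdot>c" 67) where
  "C \<cdot>c \<sigma> = image_mset (\<lambda>L. L \<cdot>l \<sigma>) C"

text \<open>Renamings preserve both the sort and the kind of variables.\<close>

definition variant :: "('f, 's) clause \<Rightarrow> ('f, 's) clause \<Rightarrow> bool" where
  "variant C C' \<longleftrightarrow> (\<exists>\<rho>. bij \<rho> \<and>
     (\<forall>x. var_sort (\<rho> x) = var_sort x \<and> (is_abstr_var (\<rho> x) \<longleftrightarrow> is_abstr_var x)) \<and>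
     C' = C \<cdot>c (\<lambda>x. Var (\<rho> x)))"


section \<open>Term-generated interpretations\<close>

record ('f, 's, 'u) interp =
  carr :: "'s \<Rightarrow> 'u set"
  op_fun :: "'f \<Rightarrow> 'u list \<Rightarrow> 'u"

definition args_in :: "('f, 's) sig \<Rightarrow> ('f, 's, 'u) interp \<Rightarrow> 'f \<Rightarrow> 'u list \<Rightarrow> bool" where
  "args_in S I f as \<longleftrightarrow> list_all2 (\<lambda>a \<xi>. a \<in> carr I \<xi>) as (arg_sorts S f)"

text \<open>
  Carriers are nonempty; with empty carriers already equality resolution would be unsound.
\<close>

definition interpretation_of :: "('f, 's) sig \<Rightarrow> ('f, 's, 'u) interp \<Rightarrow> bool" where
  "interpretation_of S I \<longleftrightarrow>
     (\<forall>\<xi>\<in>sorts S. carr I \<xi> \<noteq> {}) \<and>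
     (\<forall>f\<in>ops S. \<forall>as. args_in S I f as \<longrightarrow> op_fun I f as \<in> carr I (res_sort S f))"

text \<open>Evaluation is only ever used for ground terms.\<close>

fun eval_trm :: "('f, 's, 'u) interp \<Rightarrow> ('f, 's) trm \<Rightarrow> 'u" where
  "eval_trm I (Var x) = undefined"
| "eval_trm I (Fun f ts) = op_fun I f (map (eval_trm I) ts)"

definition term_generated :: "('f, 's) sig \<Rightarrow> ('f, 's, 'u) interp \<Rightarrow> bool" where
  "term_generated S I \<longleftrightarrow>
     (\<forall>\<xi>\<in>sorts S. carr I \<xi> = {eval_trm I t | t. gnd_trm S t \<and> trm_sort S t = \<xi>})"

fun sat_gnd_lit :: "('f, 's, 'u) interp \<Rightarrow> ('f, 's) trm lit \<Rightarrow> bool" where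
  "sat_gnd_lit I (Pos A) \<longleftrightarrow> (\<forall>s\<in>set_uprod A. \<forall>t\<in>set_uprod A. eval_trm I s = eval_trm I t)"
| "sat_gnd_lit I (Neg A) \<longleftrightarrow> \<not> (\<forall>s\<in>set_uprod A. \<forall>t\<in>set_uprod A. eval_trm I s = eval_trm I t)"

definition sat_gnd_cls :: "('f, 's, 'u) interp \<Rightarrow> ('f, 's) clause \<Rightarrow> bool" where
  "sat_gnd_cls I C \<longleftrightarrow> (\<exists>L\<in>#C. sat_gnd_lit I L)"

definition gnd_insts :: "('f, 's) sig \<Rightarrow> ('f, 's) clause \<Rightarrow> ('f, 's) clause set" where
  "gnd_insts S C =
     {C \<cdot>c \<sigma> | \<sigma>. \<forall>x\<in>vars_cls C. gnd_trm S (\<sigma> x) \<and> trm_sort S (\<sigma> x) = var_sort x}"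

definition is_model :: "('f, 's) sig \<Rightarrow> ('f, 's, 'u) interp \<Rightarrow> ('f, 's) clause set \<Rightarrow> bool" where
  "is_model S I N \<longleftrightarrow> interpretation_of S I \<and> term_generated S I \<and>
     (\<forall>C\<in>N. \<forall>C'\<in>gnd_insts S C. sat_gnd_cls I C')"

definition isomorphic ::
  "('f, 's) sig \<Rightarrow> ('f, 's, 'u) interp \<Rightarrow> ('f, 's, 'u) interp \<Rightarrow> bool" where
  "isomorphic S I J \<longleftrightarrow> (\<exists>h.
     (\<forall>\<xi>\<in>sorts S. bij_betw (h \<xi>) (carr I \<xi>) (carr J \<xi>)) \<and>
     (\<forall>f\<in>ops S. \<forall>as. args_in S I f as \<longrightarrow>
        h (res_sort S f) (op_fun I f as) = op_fun J f (map2 h (arg_sorts S f) as)))"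

definition reduct :: "('f, 's) sig \<Rightarrow> ('f, 's, 'u) interp \<Rightarrow> ('f, 's, 'u) interp" where
  "reduct S I =
     \<lparr>carr = (\<lambda>\<xi>. if \<xi> \<in> sorts S then carr I \<xi> else {}),
      op_fun = (\<lambda>f. if f \<in> ops S then op_fun I f else (\<lambda>_. undefined))\<rparr>"


section \<open>Hierarchic specifications\<close>

text \<open>
  The class of background models is a set of interpretations over an arbitrary universe type
  \<open>'u\<close>, over which all interpretations below range.  If \<open>'u\<close> is at least as large as the set of
  ground terms, every term-generated interpretation has an isomorphic copy over \<open>'u\<close>.
\<close>

record ('f, 's, 'u) hspec =
  full_sig :: "('f, 's) sig"
  bg_sorts :: "'s set"
  bg_ops :: "'f set"
  dom_elems :: "'f set"
  params :: "'f set"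
  bg_models :: "('f, 's, 'u) interp set"

definition bg_sig :: "('f, 's, 'u) hspec \<Rightarrow> ('f, 's) sig" where
  "bg_sig H = (full_sig H)\<lparr>sorts := bg_sorts H, ops := bg_ops H\<rparr>"

text \<open>
  In the last condition \<open>J\<close> is not required to be term-generated: the choice of values for the
  parameters is completely free.
\<close>

definition hierarchic_spec :: "('f, 's, 'u) hspec \<Rightarrow> bool" where
  "hierarchic_spec H \<longleftrightarrow>
     wf_sig (full_sig H) \<and> wf_sig (bg_sig H) \<and>
     bg_sorts H \<subseteq> sorts (full_sig H) \<and> bg_ops H \<subseteq> ops (full_sig H) \<and>
     dom_elems H \<subseteq> bg_ops H \<and> params H \<subseteq> bg_ops H \<and>
     (\<forall>c\<in>dom_elems H \<union> params H. arg_sorts (full_sig H) c = []) \<and>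
     (\<forall>I\<in>bg_models H. interpretation_of (bg_sig H) I \<and> term_generated (bg_sig H) I) \<and>
     (\<forall>I\<in>bg_models H. \<forall>J. interpretation_of (bg_sig H) J \<and> isomorphic (bg_sig H) I J \<longrightarrow>
        J \<in> bg_models H) \<and>
     (\<forall>I\<in>bg_models H. \<forall>d\<in>dom_elems H. \<forall>e\<in>dom_elems H.
        d \<noteq> e \<and> res_sort (full_sig H) d = res_sort (full_sig H) e \<longrightarrow>
        op_fun I d [] \<noteq> op_fun I e []) \<and>
     (\<forall>I\<in>bg_models H. \<forall>J. interpretation_of (bg_sig H) J \<and>
        (\<forall>\<xi>\<in>bg_sorts H. carr J \<xi> = carr I \<xi>) \<and>
        (\<forall>f\<in>bg_ops H - params H. \<forall>as. args_in (bg_sig H) I f as \<longrightarrow> op_fun J f as = op_fun I f as) \<longrightarrow>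
        J \<in> bg_models H)"

definition wf_trm :: "('f, 's, 'u) hspec \<Rightarrow> ('f, 's) trm \<Rightarrow> bool" where
  "wf_trm H t \<longleftrightarrow> well_sorted (full_sig H) t \<and>
     (\<forall>x\<in>vars_trm t. is_abstr_var x \<longrightarrow> var_sort x \<in> bg_sorts H)"

definition wf_cls :: "('f, 's, 'u) hspec \<Rightarrow> ('f, 's) clause \<Rightarrow> bool" where
  "wf_cls H C \<longleftrightarrow>
     (\<forall>L\<in>#C. \<exists>\<xi>. \<forall>t\<in>set_lit L. wf_trm H t \<and> trm_sort (full_sig H) t = \<xi>)"

definition bg_trm :: "('f, 's, 'u) hspec \<Rightarrow> ('f, 's) trm \<Rightarrow> bool" where
  "bg_trm H t \<longleftrightarrow> well_sorted (bg_sig H) t"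

definition pure_bg_trm :: "('f, 's, 'u) hspec \<Rightarrow> ('f, 's) trm \<Rightarrow> bool" where
  "pure_bg_trm H t \<longleftrightarrow> bg_trm H t \<and> (\<forall>x\<in>vars_trm t. is_abstr_var x)"

definition bg_cls :: "('f, 's, 'u) hspec \<Rightarrow> ('f, 's) clause \<Rightarrow> bool" where
  "bg_cls H C \<longleftrightarrow> (\<forall>L\<in>#C. \<forall>t\<in>set_lit L. bg_trm H t)"

definition b_entails ::
  "('f, 's, 'u) hspec \<Rightarrow> ('f, 's) clause set \<Rightarrow> ('f, 's) clause set \<Rightarrow> bool" where
  "b_entails H N N' \<longleftrightarrow>
     (\<forall>I. is_model (full_sig H) I N \<and> reduct (bg_sig H) I \<in> bg_models H \<longrightarrow>
          is_model (full_sig H) I N')"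

definition wf_subst :: "('f, 's, 'u) hspec \<Rightarrow> ('f, 's) subst \<Rightarrow> bool" where
  "wf_subst H \<sigma> \<longleftrightarrow> (\<forall>x. wf_trm H (Var x) \<longrightarrow>
     wf_trm H (\<sigma> x) \<and> trm_sort (full_sig H) (\<sigma> x) = var_sort x)"

definition simple_subst :: "('f, 's, 'u) hspec \<Rightarrow> ('f, 's) subst \<Rightarrow> bool" where
  "simple_subst H \<sigma> \<longleftrightarrow> wf_subst H \<sigma> \<and>
     (\<forall>x. wf_trm H (Var x) \<and> is_abstr_var x \<longrightarrow> pure_bg_trm H (\<sigma> x))"

text \<open>
  A simple mgu is a most general one among the simple unifiers.  Generality is compared on the
  variables \<open>V\<close> of the premises only, because a simple mgu may have to introduce new variables:
  the terms \<open>X\<close> and \<open>1 + y\<close> have the simple mgu that maps \<open>X\<close> to \<open>1 + Y\<close> and \<open>y\<close> to \<open>Y\<close>.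
\<close>

definition simple_mgu ::
  "('f, 's, 'u) hspec \<Rightarrow> 's var set \<Rightarrow> ('f, 's) subst \<Rightarrow> ('f, 's) trm \<Rightarrow> ('f, 's) trm \<Rightarrow> bool" where
  "simple_mgu H V \<sigma> s t \<longleftrightarrow> simple_subst H \<sigma> \<and> s \<cdot> \<sigma> = t \<cdot> \<sigma> \<and>
     (\<forall>\<tau>. simple_subst H \<tau> \<and> s \<cdot> \<tau> = t \<cdot> \<tau> \<longrightarrow>
        (\<exists>\<rho>. simple_subst H \<rho> \<and> (\<forall>x\<in>V. \<tau> x = (\<sigma> \<odot> \<rho>) x)))"


section \<open>Weak abstraction and unabstraction\<close>

text \<open>
  \<open>target H f us q\<close>: the term \<open>q\<close> is a target term as an argument of \<open>f\<close> with the other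
  arguments \<open>us\<close>.  A term is an FG or impure BG term iff it is not a pure BG term.
\<close>

definition target ::
  "('f, 's, 'u) hspec \<Rightarrow> 'f \<Rightarrow> ('f, 's) trm list \<Rightarrow> ('f, 's) trm \<Rightarrow> bool" where
  "target H f us q \<longleftrightarrow>
     bg_trm H q \<and> (\<forall>x. q \<noteq> Var x) \<and> (\<forall>d\<in>dom_elems H. q \<noteq> Fun d []) \<and>
     (f \<notin> bg_ops H \<or> (\<exists>u\<in>set us. \<not> pure_bg_trm H u))"

definition weakly_abstracted :: "('f, 's, 'u) hspec \<Rightarrow> ('f, 's) clause \<Rightarrow> bool" where
  "weakly_abstracted H C \<longleftrightarrow>
     (\<forall>L\<in>#C. \<forall>s\<in>set_lit L. \<forall>c f ss q ts. s = c\<langle>Fun f (ss @ q # ts)\<rangle> \<longrightarrow> \<not> target H f (ss @ ts) q)"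

inductive abstr_step ::
  "('f, 's, 'u) hspec \<Rightarrow> ('f, 's) clause \<Rightarrow> ('f, 's) clause \<Rightarrow> bool"
  for H :: "('f, 's, 'u) hspec"
where
  "\<lbrakk> C = add_mset (K (Upair (c\<langle>Fun f (ss @ q # ts)\<rangle>) t)) D; K \<in> {Pos, Neg};
     target H f (ss @ ts) q;
     x = (if pure_bg_trm H q then AbstrVar n (trm_sort (full_sig H) q)
          else OrdVar n (trm_sort (full_sig H) q));
     x \<notin> vars_cls C \<rbrakk> \<Longrightarrow>
   abstr_step H C
     (add_mset (K (Upair (c\<langle>Fun f (ss @ Var x # ts)\<rangle>) t)) (add_mset (Var x !\<approx> q) D))"

text \<open>
  \<open>abstr\<close> depends on the order of the replacements and on the choice of the fresh variables,
  so it is a relation.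
\<close>

definition is_abstr :: "('f, 's, 'u) hspec \<Rightarrow> ('f, 's) clause \<Rightarrow> ('f, 's) clause \<Rightarrow> bool" where
  "is_abstr H C C' \<longleftrightarrow> (abstr_step H)\<^sup>*\<^sup>* C C' \<and> weakly_abstracted H C'"

text \<open>
  \<open>unabstr_run C \<sigma> C'\<close>: some unabstraction steps lead from \<open>C\<close> to \<open>C'\<close>, where \<open>\<sigma>\<close> is the
  composition of all instantiations made.
\<close>

inductive unabstr_run ::
  "('f, 's) clause \<Rightarrow> ('f, 's) subst \<Rightarrow> ('f, 's) clause \<Rightarrow> bool"
  for C :: "('f, 's) clause"
where
  init: "unabstr_run C Var C"
| step: "\<lbrakk> unabstr_run C \<sigma> (add_mset (Var z !\<approx> t) D); t = Var z \<or> z \<notin> vars_trm t \<rbrakk> \<Longrightarrow>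
    unabstr_run C (\<sigma> \<odot> Var(z := t)) (D \<cdot>c Var(z := t))"

definition is_unabstr ::
  "('f, 's) clause \<Rightarrow> ('f, 's) subst \<Rightarrow> ('f, 's) clause \<Rightarrow> bool" where
  "is_unabstr C \<sigma> C' \<longleftrightarrow> unabstr_run C \<sigma> C' \<and>
     (\<nexists>z t. (Var z !\<approx> t) \<in># C' \<and> (t = Var z \<or> z \<notin> vars_trm t))"

definition unabstracted_version ::
  "('f, 's) clause \<Rightarrow> ('f, 's) trm \<Rightarrow> ('f, 's) trm \<Rightarrow> bool" where
  "unabstracted_version C t t' \<longleftrightarrow> (\<exists>\<sigma> C'. is_unabstr C \<sigma> C' \<and> t' = t \<cdot> \<sigma>)"


section \<open>Orderings, selection and redundancy\<close>

text \<open>Orderings are given by their \<open>smaller than\<close> relation \<open>lt\<close>.\<close>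

definition hierarchic_reduction_ordering ::
  "('f, 's, 'u) hspec \<Rightarrow> (('f, 's) trm \<Rightarrow> ('f, 's) trm \<Rightarrow> bool) \<Rightarrow> bool" where
  "hierarchic_reduction_ordering H lt \<longleftrightarrow>
     (let T = {t. wf_trm H t}; G = {t. gnd_trm (full_sig H) t} in
       transp_on T lt \<and> wfp_on T lt \<and>
       (\<forall>s\<in>T. \<forall>t\<in>T. \<forall>c. lt s t \<and> c\<langle>s\<rangle> \<in> T \<and> c\<langle>t\<rangle> \<in> T \<longrightarrow> lt (c\<langle>s\<rangle>) (c\<langle>t\<rangle>)) \<and>
       (\<forall>s\<in>T. \<forall>t\<in>T. \<forall>\<sigma>. lt s t \<and> simple_subst H \<sigma> \<longrightarrow> lt (s \<cdot> \<sigma>) (t \<cdot> \<sigma>)) \<and>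
       totalp_on G lt \<and>
       (\<forall>d\<in>dom_elems H. \<forall>s\<in>G. (\<forall>e\<in>dom_elems H. s \<noteq> Fun e []) \<longrightarrow> lt (Fun d []) s) \<and>
       (\<forall>s\<in>G. \<forall>t\<in>G. \<not> bg_trm H s \<and> bg_trm H t \<longrightarrow> lt t s))"

lift_definition mset_uprod :: "'a uprod \<Rightarrow> 'a multiset" is "\<lambda>(s, t). {#s, t#}"
  by auto

fun mset_lit :: "'a lit \<Rightarrow> 'a multiset" where
  "mset_lit (Pos A) = mset_uprod A"
| "mset_lit (Neg A) = mset_uprod A + mset_uprod A"

definition lt_lit :: "('a \<Rightarrow> 'a \<Rightarrow> bool) \<Rightarrow> 'a lit \<Rightarrow> 'a lit \<Rightarrow> bool" where
  "lt_lit lt L K \<longleftrightarrow> multp lt (mset_lit L) (mset_lit K)"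

definition lt_cls :: "('a \<Rightarrow> 'a \<Rightarrow> bool) \<Rightarrow> 'a lit multiset \<Rightarrow> 'a lit multiset \<Rightarrow> bool" where
  "lt_cls lt = multp (lt_lit lt)"

definition maximal_lit :: "('a \<Rightarrow> 'a \<Rightarrow> bool) \<Rightarrow> 'a lit \<Rightarrow> 'a lit multiset \<Rightarrow> bool" where
  "maximal_lit lt L C \<longleftrightarrow> L \<in># C \<and> (\<forall>K\<in>#C. \<not> lt_lit lt L K)"

definition strictly_maximal_lit :: "('a \<Rightarrow> 'a \<Rightarrow> bool) \<Rightarrow> 'a lit \<Rightarrow> 'a lit multiset \<Rightarrow> bool" where
  "strictly_maximal_lit lt L C \<longleftrightarrow> L \<in># C \<and> (\<forall>K\<in>#C - {#L#}. \<not> lt_lit lt L K \<and> K \<noteq> L)"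

definition selection_function :: "(('f, 's) clause \<Rightarrow> ('f, 's) clause) \<Rightarrow> bool" where
  "selection_function sel \<longleftrightarrow> (\<forall>C. sel C \<subseteq># C \<and> (\<forall>L\<in>#sel C. \<not> is_pos L))"

definition sgi :: "('f, 's, 'u) hspec \<Rightarrow> ('f, 's) clause \<Rightarrow> ('f, 's) clause set" where
  "sgi H C = {C \<cdot>c \<sigma> | \<sigma>. simple_subst H \<sigma> \<and> vars_cls (C \<cdot>c \<sigma>) = {}}"

text \<open>
  Every quantifier-free ground formula is equivalent to a finite set of ground clauses, so the
  ground theory is represented by clauses.
\<close>

definition GndTh :: "('f, 's, 'u) hspec \<Rightarrow> ('f, 's) clause set" where
  "GndTh H = {C. wf_cls H C \<and> bg_cls H C \<and> vars_cls C = {} \<and> (\<forall>I\<in>bg_models H. sat_gnd_cls I C)}"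

definition Red_F ::
  "('f, 's, 'u) hspec \<Rightarrow> (('f, 's) trm \<Rightarrow> ('f, 's) trm \<Rightarrow> bool) \<Rightarrow>
   ('f, 's) clause set \<Rightarrow> ('f, 's) clause set" where
  "Red_F H lt M = {C. wf_cls H C \<and> vars_cls C = {} \<and>
     (\<exists>M'\<subseteq>M. finite M' \<and> (\<forall>D\<in>M'. lt_cls lt D C) \<and>
        (\<forall>I :: ('f, 's, 'u) interp. is_model (full_sig H) I M' \<longrightarrow> is_model (full_sig H) I {C}))}"

definition Red_H ::
  "('f, 's, 'u) hspec \<Rightarrow> (('f, 's) trm \<Rightarrow> ('f, 's) trm \<Rightarrow> bool) \<Rightarrow>
   ('f, 's) clause set \<Rightarrow> ('f, 's) clause set" where
  "Red_H H lt N = {C. wf_cls H C \<and> weakly_abstracted H C \<and>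
     sgi H C \<subseteq> Red_F H lt ((\<Union>D\<in>N. sgi H D) \<union> GndTh H) \<union> GndTh H}"


section \<open>The calculus\<close>

text \<open>\<open>hsp_base H lt sel N C\<close>: there is a base inference with premises in \<open>N\<close> and conclusion \<open>C\<close>.\<close>

inductive hsp_base ::
  "('f, 's, 'u) hspec \<Rightarrow> (('f, 's) trm \<Rightarrow> ('f, 's) trm \<Rightarrow> bool) \<Rightarrow>
   (('f, 's) clause \<Rightarrow> ('f, 's) clause) \<Rightarrow> ('f, 's) clause set \<Rightarrow> ('f, 's) clause \<Rightarrow> bool"
  for H :: "('f, 's, 'u) hspec" and lt :: "('f, 's) trm \<Rightarrow> ('f, 's) trm \<Rightarrow> bool"
  and sel :: "('f, 's) clause \<Rightarrow> ('f, 's) clause" and N :: "('f, 's) clause set"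
where
  equality_resolution:
  "\<lbrakk> P \<in> N; weakly_abstracted H P;
     P = add_mset (s !\<approx> t) C;
     \<not> pure_bg_trm H s; \<not> pure_bg_trm H t;
     simple_mgu H (vars_cls P) \<sigma> s t;
     if sel P \<noteq> {#} then (s !\<approx> t) \<in># sel P
     else maximal_lit lt ((s !\<approx> t) \<cdot>l \<sigma>) (P \<cdot>c \<sigma>);
     is_abstr H (C \<cdot>c \<sigma>) E \<rbrakk> \<Longrightarrow>
   hsp_base H lt sel N E"
| negative_superposition:
  "\<lbrakk> P1 \<in> N; P2 \<in> N; weakly_abstracted H P1; weakly_abstracted H P2;
     variant P1 Q1; variant P2 Q2; vars_cls Q1 \<inter> vars_cls Q2 = {};
     Q1 = add_mset (l \<approx> r) C; Q2 = add_mset (c\<langle>u\<rangle> !\<approx> t) D;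
     \<forall>x. u \<noteq> Var x;
     \<not> pure_bg_trm H l; \<not> pure_bg_trm H u;
     simple_mgu H (vars_cls Q1 \<union> vars_cls Q2) \<sigma> l u;
     \<not> lt\<^sup>=\<^sup>= (l \<cdot> \<sigma>) (r \<cdot> \<sigma>);
     strictly_maximal_lit lt ((l \<approx> r) \<cdot>l \<sigma>) (Q1 \<cdot>c \<sigma>);
     sel Q1 = {#};
     \<not> lt\<^sup>=\<^sup>= (c\<langle>u\<rangle> \<cdot> \<sigma>) (t \<cdot> \<sigma>);
     if sel Q2 \<noteq> {#} then (c\<langle>u\<rangle> !\<approx> t) \<in># sel Q2
     else maximal_lit lt ((c\<langle>u\<rangle> !\<approx> t) \<cdot>l \<sigma>) (Q2 \<cdot>c \<sigma>);
     is_abstr H (add_mset (c\<langle>r\<rangle> !\<approx> t) (C + D) \<cdot>c \<sigma>) E \<rbrakk> \<Longrightarrow>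
   hsp_base H lt sel N E"
| positive_superposition:
  "\<lbrakk> P1 \<in> N; P2 \<in> N; weakly_abstracted H P1; weakly_abstracted H P2;
     variant P1 Q1; variant P2 Q2; vars_cls Q1 \<inter> vars_cls Q2 = {};
     Q1 = add_mset (l \<approx> r) C; Q2 = add_mset (c\<langle>u\<rangle> \<approx> t) D;
     \<forall>x. u \<noteq> Var x;
     \<not> pure_bg_trm H l; \<not> pure_bg_trm H u;
     simple_mgu H (vars_cls Q1 \<union> vars_cls Q2) \<sigma> l u;
     \<not> lt\<^sup>=\<^sup>= (l \<cdot> \<sigma>) (r \<cdot> \<sigma>);
     strictly_maximal_lit lt ((l \<approx> r) \<cdot>l \<sigma>) (Q1 \<cdot>c \<sigma>);
     sel Q1 = {#};
     \<not> lt\<^sup>=\<^sup>= (c\<langle>u\<rangle> \<cdot> \<sigma>) (t \<cdot> \<sigma>);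
     strictly_maximal_lit lt ((c\<langle>u\<rangle> \<approx> t) \<cdot>l \<sigma>) (Q2 \<cdot>c \<sigma>);
     sel Q2 = {#};
     is_abstr H (add_mset (c\<langle>r\<rangle> \<approx> t) (C + D) \<cdot>c \<sigma>) E \<rbrakk> \<Longrightarrow>
   hsp_base H lt sel N E"
| equality_factoring:
  "\<lbrakk> P \<in> N; weakly_abstracted H P;
     P = add_mset (s \<approx> t) (add_mset (l \<approx> r) C);
     \<not> pure_bg_trm H s; \<not> pure_bg_trm H l;
     simple_mgu H (vars_cls P) \<sigma> s l;
     maximal_lit lt ((s \<approx> t) \<cdot>l \<sigma>) (P \<cdot>c \<sigma>);
     sel P = {#};
     \<not> lt\<^sup>=\<^sup>= (s \<cdot> \<sigma>) (t \<cdot> \<sigma>);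
     \<not> lt\<^sup>=\<^sup>= (l \<cdot> \<sigma>) (r \<cdot> \<sigma>);
     is_abstr H (add_mset (l \<approx> r) (add_mset (t !\<approx> r) C) \<cdot>c \<sigma>) E \<rbrakk> \<Longrightarrow>
   hsp_base H lt sel N E"
| close:
  "\<lbrakk> M \<subseteq> N; finite M; \<forall>C\<in>M. bg_cls H C \<and> weakly_abstracted H C;
     \<nexists>I. I \<in> bg_models H \<and> is_model (bg_sig H) I M \<rbrakk> \<Longrightarrow>
   hsp_base H lt sel N {#}"

definition fg_headed_bg_sorted :: "('f, 's, 'u) hspec \<Rightarrow> ('f, 's) trm \<Rightarrow> bool" where
  "fg_headed_bg_sorted H t \<longleftrightarrow> trm_sort (full_sig H) t \<in> bg_sorts H \<and>
     (\<exists>f ts. t = Fun f ts \<and> f \<notin> bg_ops H)"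

text \<open>
  \<open>par\<close> assigns to each ground term \<open>t\<close> the parameter that names it.  This parameter must
  be reserved for naming \<open>t\<close>: either it does not occur in the premises at all, or its
  definition has been introduced before and is among the premises.  Otherwise the new
  definition could contradict what the premises say about the parameter.
\<close>

definition reserved ::
  "('f, 's, 'u) hspec \<Rightarrow> ('f, 's) clause set \<Rightarrow> ('f, 's) trm \<Rightarrow> 'f \<Rightarrow> bool" where
  "reserved H N t a \<longleftrightarrow>
     (\<forall>C\<in>N. a \<notin> ops_cls C) \<or> (\<exists>E\<in>N. is_abstr H {#t \<approx> Fun a []#} E)"

inductive define_rule ::
  "('f, 's, 'u) hspec \<Rightarrow> (('f, 's) trm \<Rightarrow> ('f, 's) trm \<Rightarrow> bool) \<Rightarrow> (('f, 's) trm \<Rightarrow> 'f) \<Rightarrow>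
   ('f, 's) clause set \<Rightarrow> ('f, 's) clause set \<Rightarrow> bool"
  for H :: "('f, 's, 'u) hspec" and lt :: "('f, 's) trm \<Rightarrow> ('f, 's) trm \<Rightarrow> bool"
  and par :: "('f, 's) trm \<Rightarrow> 'f"
where
  "\<lbrakk> P = add_mset (K (Upair (c\<langle>t\<rangle>) u)) D; K \<in> {Pos, Neg}; weakly_abstracted H P;
     fg_headed_bg_sorted H t;
     \<forall>c' s. t = c'\<langle>s\<rangle> \<and> c' \<noteq> Hole \<longrightarrow> \<not> fg_headed_bg_sorted H s;
     unabstracted_version P t t';
     vars_trm t' = {};
     a = par t'; a \<in> params H; res_sort (full_sig H) a = trm_sort (full_sig H) t';
     reserved H (N \<union> {P}) t' a;
     is_abstr H {#t' \<approx> Fun a []#} E1;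
     is_abstr H (add_mset (K (Upair (c\<langle>Fun a []\<rangle>) u)) D) E2;
     P \<in> Red_H H lt (N \<union> {E1, E2}) \<rbrakk> \<Longrightarrow>
   define_rule H lt par (N \<union> {P}) (N \<union> {E1, E2})"

definition hsp_inference ::
  "('f, 's, 'u) hspec \<Rightarrow> (('f, 's) trm \<Rightarrow> ('f, 's) trm \<Rightarrow> bool) \<Rightarrow>
   (('f, 's) clause \<Rightarrow> ('f, 's) clause) \<Rightarrow> (('f, 's) trm \<Rightarrow> 'f) \<Rightarrow>
   ('f, 's) clause set \<Rightarrow> ('f, 's) clause set \<Rightarrow> bool" where
  "hsp_inference H lt sel par N N' \<longleftrightarrow>
     (\<exists>C. hsp_base H lt sel N C \<and> N' = N \<union> {C}) \<or> define_rule H lt par N N'"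

end

theory Submission
  imports Defs
begin

text \<open>
  In a term-generated interpretation, a clause holds in all ground instances iff it holds under
  all valuations of its variables in the carriers.  Under valuations, weak abstraction is sound
  in both directions, and substitution instances and the base inferences are sound.  For Define,
  a valuation that falsifies the other literals of the premise gives a term and its unabstracted
  version the same value; so together with the definition of the parameter, the premise entails
  the conclusion.  Conversely the premise is recovered from its redundancy.
\<close>

section \<open>Satisfaction under valuations\<close>

text \<open>On valuations, undoing an abstraction step is a mere update: the fresh variable receives
  the value of the abstracted term. A base inference is sound within one model. Define is not: the
  parameter may have the wrong value, so the model itself may have to change, and only the existence
  of a model carries over. Two obstacles arise there. Changing a parameter could leave elements
  without a name, although models must be term-generated. And the unabstracted version is computed
  from the whole premise, including the very literal to be replaced, which a given valuation need
  not falsify. This forces an invariant on unabstraction runs that admits variables with wrong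
  values, provided their instances are non-variable terms containing every variable of the instance
  of the term being defined.\<close>

fun val :: "('f, 's, 'u) interp \<Rightarrow> ('s var \<Rightarrow> 'u) \<Rightarrow> ('f, 's) trm \<Rightarrow> 'u" where
  "val I \<beta> (Var x) = \<beta> x"
| "val I \<beta> (Fun f ts) = op_fun I f (map (val I \<beta>) ts)"

definition valuation :: "('f, 's) sig \<Rightarrow> ('f, 's, 'u) interp \<Rightarrow> ('s var \<Rightarrow> 'u) \<Rightarrow> bool" where
  "valuation S I \<beta> \<longleftrightarrow> (\<forall>x. var_sort x \<in> sorts S \<longrightarrow> \<beta> x \<in> carr I (var_sort x))"

text \<open>Truth is parametrised by an evaluation function \<open>e\<close>, so a substitution can
  be moved out of a clause into \<open>e\<close>, and one congruence rule covers changes of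
  valuation, of interpretation and passage to a reduct.\<close>

fun lit_holds :: "('a \<Rightarrow> 'u) \<Rightarrow> 'a lit \<Rightarrow> bool" where
  "lit_holds e (Pos A) \<longleftrightarrow> (\<forall>s\<in>set_uprod A. \<forall>t\<in>set_uprod A. e s = e t)"
| "lit_holds e (Neg A) \<longleftrightarrow> \<not> (\<forall>s\<in>set_uprod A. \<forall>t\<in>set_uprod A. e s = e t)"

definition cls_holds :: "('a \<Rightarrow> 'u) \<Rightarrow> 'a lit multiset \<Rightarrow> bool" where
  "cls_holds e C \<longleftrightarrow> (\<exists>L\<in>#C. lit_holds e L)"

definition valid :: "('f, 's) sig \<Rightarrow> ('f, 's, 'u) interp \<Rightarrow> ('f, 's) clause \<Rightarrow> bool" where
  "valid S I C \<longleftrightarrow> (\<forall>\<beta>. valuation S I \<beta> \<longrightarrow> cls_holds (val I \<beta>) C)"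

lemma validD: "valid S I C \<Longrightarrow> valuation S I \<beta> \<Longrightarrow> cls_holds (val I \<beta>) C"
  by (simp add: valid_def)

lemma lit_holds_Upair [simp]:
  "lit_holds e (Pos (Upair s t)) \<longleftrightarrow> e s = e t"
  "lit_holds e (Neg (Upair s t)) \<longleftrightarrow> e s \<noteq> e t"
  by auto

lemma lit_holds_cong:
  assumes "\<And>t. t \<in> set_lit L \<Longrightarrow> e t = e' t"
  shows "lit_holds e L = lit_holds e' L"
  using assms by (cases L) auto

lemma lit_holds_map: "lit_holds e (map_lit f L) = lit_holds (\<lambda>t. e (f t)) L"
  by (cases L) (auto simp: uprod.set_map)

lemma cls_holds_cong:
  assumes "\<And>L t. L \<in># C \<Longrightarrow> t \<in> set_lit L \<Longrightarrow> e t = e' t"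
  shows "cls_holds e C = cls_holds e' C"
  unfolding cls_holds_def by (intro bex_cong lit_holds_cong assms refl)

lemma cls_holds_simps [simp]:
  "cls_holds e (add_mset L C) \<longleftrightarrow> lit_holds e L \<or> cls_holds e C"
  "cls_holds e (C + D) \<longleftrightarrow> cls_holds e C \<or> cls_holds e D"
  "\<not> cls_holds e {#}"
  by (auto simp: cls_holds_def)

lemma val_subst: "val I \<beta> (t \<cdot> \<sigma>) = val I (\<lambda>x. val I \<beta> (\<sigma> x)) t"
  by (induction t) (auto cong: map_cong)

lemma lit_holds_subst: "lit_holds e (L \<cdot>l \<sigma>) = lit_holds (\<lambda>t. e (t \<cdot> \<sigma>)) L"
  by (simp add: subst_lit_def lit_holds_map)

lemma cls_holds_subst: "cls_holds e (C \<cdot>c \<sigma>) = cls_holds (\<lambda>t. e (t \<cdot> \<sigma>)) C"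
  by (simp add: subst_cls_def cls_holds_def lit_holds_subst)

text \<open>Valuation and interpretation vary together because both kinds of irrelevance occur: that
  of a fresh variable in abstraction, and that of operators outside a reduct or of a reserved
  parameter.\<close>

lemma val_cong:
  assumes "\<And>x. x \<in> vars_trm t \<Longrightarrow> \<beta> x = \<gamma> x"
    and "\<And>f. f \<in> ops_trm t \<Longrightarrow> op_fun I f = op_fun J f"
  shows "val I \<beta> t = val J \<gamma> t"
  using assms
proof (induction t)
  case (Fun f ts)
  have "val I \<beta> t = val J \<gamma> t" if "t \<in> set ts" for t
    using that by (intro Fun.IH Fun.prems) auto
  then have "map (val I \<beta>) ts = map (val J \<gamma>) ts" by simp
  then show ?case using Fun.prems(2)[of f] by (simp del: map_eq_conv)
qed simp

lemma cls_holds_val_cong: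
  assumes "\<And>x. x \<in> vars_cls C \<Longrightarrow> \<beta> x = \<gamma> x"
    and "\<And>f. f \<in> ops_cls C \<Longrightarrow> op_fun I f = op_fun J f"
  shows "cls_holds (val I \<beta>) C = cls_holds (val J \<gamma>) C"
proof (intro cls_holds_cong val_cong)
  fix L t assume Lt: "L \<in># C" "t \<in> set_lit L"
  show "\<beta> x = \<gamma> x" if "x \<in> vars_trm t" for x
    using assms(1)[of x] Lt that unfolding vars_cls_def by blast
  show "op_fun I f = op_fun J f" if "f \<in> ops_trm t" for f
    using assms(2)[of f] Lt that unfolding ops_cls_def by blast
qed

lemma val_ctxt: "val I \<beta> s = val I \<beta> t \<Longrightarrow> val I \<beta> (c\<langle>s\<rangle>) = val I \<beta> (c\<langle>t\<rangle>)"
  by (induction c) auto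

text \<open>\<open>eval_trm\<close> sends every variable to \<open>undefined\<close>, so it
  literally is \<open>val\<close> under this constant valuation, even on non-ground terms. Hence the
  recurring \<open>\<lambda>_. undefined\<close>.\<close>

lemma eval_trm_val: "eval_trm I t = val I (\<lambda>_. undefined) t"
  by (induction t) (auto cong: map_cong)

lemma eval_trm_gnd: "vars_trm t = {} \<Longrightarrow> eval_trm I t = val I \<beta> t"
  unfolding eval_trm_val by (rule val_cong) auto

lemma sat_gnd_cls_val: "sat_gnd_cls I C = cls_holds (val I (\<lambda>_. undefined)) C"
proof -
  have "sat_gnd_lit I L = lit_holds (val I (\<lambda>_. undefined)) L" for L
    by (cases L) (auto simp: eval_trm_val)
  then show ?thesis by (simp add: sat_gnd_cls_def cls_holds_def)
qed

lemma args_in_map: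
  assumes "\<And>t. t \<in> set ts \<Longrightarrow> g t \<in> carr I (trm_sort S t)"
    and "map (trm_sort S) ts = arg_sorts S f"
  shows "args_in S I f (map g ts)"
  unfolding args_in_def assms(2)[symmetric] using assms(1)
  by (simp add: list_all2_conv_all_nth)

lemma val_in_carr:
  assumes I: "interpretation_of S I" and \<beta>: "valuation S I \<beta>"
  shows "well_sorted S t \<Longrightarrow> val I \<beta> t \<in> carr I (trm_sort S t)"
proof (induction t)
  case (Var x)
  then show ?case using \<beta> by (simp add: valuation_def)
next
  case (Fun f ts)
  then have "args_in S I f (map (val I \<beta>) ts)" by (intro args_in_map) auto
  then show ?case using I Fun.prems by (simp add: interpretation_of_def)
qed

lemma ex_valuation:
  assumes "interpretation_of S I"
  shows "\<exists>\<beta>. valuation S I \<beta>"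
proof
  show "valuation S I (\<lambda>x. SOME a. a \<in> carr I (var_sort x))"
    using assms by (auto simp: valuation_def interpretation_of_def intro: someI)
qed

lemma eval_in_carr:
  assumes I: "interpretation_of S I" and t: "gnd_trm S t"
  shows "eval_trm I t \<in> carr I (trm_sort S t)"
proof -
  obtain \<beta> where "valuation S I \<beta>" using ex_valuation[OF I] by blast
  then show ?thesis using val_in_carr[OF I] t eval_trm_gnd[of t I \<beta>] by (auto simp: gnd_trm_def)
qed

section \<open>Substitutions, variables and ground clauses\<close>

lemma vars_subst_trm: "vars_trm (t \<cdot> \<sigma>) = (\<Union>x\<in>vars_trm t. vars_trm (\<sigma> x))"
  by (induction t) auto

lemma set_subst_lit: "set_lit (L \<cdot>l \<sigma>) = (\<lambda>t. t \<cdot> \<sigma>) ` set_lit L"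
  by (simp add: subst_lit_def lit.set_map)

lemma vars_subst_cls: "vars_cls (C \<cdot>c \<sigma>) = (\<Union>x\<in>vars_cls C. vars_trm (\<sigma> x))"
  by (auto simp: vars_cls_def subst_cls_def set_subst_lit vars_subst_trm)

lemma subst_trm_cong: "(\<And>x. x \<in> vars_trm t \<Longrightarrow> \<sigma> x = \<tau> x) \<Longrightarrow> t \<cdot> \<sigma> = t \<cdot> \<tau>"
  by (induction t) auto

lemma subst_trm_Var [simp]: "t \<cdot> Var = t"
  by (induction t) (auto simp: map_idI)

lemma subst_cls_gnd: "vars_cls C = {} \<Longrightarrow> C \<cdot>c \<sigma> = C"
proof -
  assume C: "vars_cls C = {}"
  have "L \<cdot>l \<sigma> = L" if "L \<in># C" for L
  proof -
    have "t \<cdot> \<sigma> = t" if "t \<in> set_lit L" for t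
      using subst_trm_cong[of t \<sigma> Var] C \<open>L \<in># C\<close> that by (auto simp: vars_cls_def)
    then show ?thesis by (simp add: subst_lit_def lit.map_ident cong: lit.map_cong)
  qed
  then show ?thesis by (simp add: subst_cls_def cong: image_mset_cong)
qed

lemma gnd_insts_gnd: "vars_cls C = {} \<Longrightarrow> gnd_insts S C = {C}"
  by (auto simp: gnd_insts_def subst_cls_gnd)

lemma subst_comp: "t \<cdot> (\<sigma> \<odot> \<tau>) = t \<cdot> \<sigma> \<cdot> \<tau>"
  by (induction t) (auto simp: comp_subst_def)

lemma subst_lit_comp: "L \<cdot>l (\<sigma> \<odot> \<tau>) = L \<cdot>l \<sigma> \<cdot>l \<tau>"
  by (simp add: subst_lit_def lit.map_comp subst_comp comp_def)

lemma valid_gnd_insts: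
  assumes I: "interpretation_of S I" and C: "valid S I C" and C': "C' \<in> gnd_insts S C"
  shows "sat_gnd_cls I C'"
proof -
  obtain \<sigma> where C'_eq: "C' = C \<cdot>c \<sigma>"
    and \<sigma>: "\<And>x. x \<in> vars_cls C \<Longrightarrow> gnd_trm S (\<sigma> x) \<and> trm_sort S (\<sigma> x) = var_sort x"
    using C' by (auto simp: gnd_insts_def)
  obtain \<gamma> where \<gamma>: "valuation S I \<gamma>" using ex_valuation[OF I] by blast
  \<comment> \<open>Off the variables of \<open>C\<close> the substitution is unconstrained, so
    \<open>\<beta>\<close> falls back on \<open>\<gamma>\<close> there; nonempty carriers provide
    \<open>\<gamma>\<close>.\<close>
  define \<beta> where "\<beta> = (\<lambda>x. if x \<in> vars_cls C then eval_trm I (\<sigma> x) else \<gamma> x)"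
  have "valuation S I \<beta>"
    using \<gamma> eval_in_carr[OF I] \<sigma> by (auto simp: valuation_def \<beta>_def) metis
  then have "cls_holds (val I \<beta>) C" using C by (simp add: valid_def)
  then have "cls_holds (val I (\<lambda>x. val I (\<lambda>_. undefined) (\<sigma> x))) C"
    by (subst cls_holds_val_cong[where \<gamma> = \<beta> and J = I]) (auto simp: \<beta>_def eval_trm_val)
  then show ?thesis by (simp add: C'_eq sat_gnd_cls_val cls_holds_subst val_subst)
qed

lemma valid_is_model:
  assumes "interpretation_of S I" "term_generated S I" "\<And>C. C \<in> N \<Longrightarrow> valid S I C"
  shows "is_model S I N"
  unfolding is_model_def using assms valid_gnd_insts[OF assms(1)] by blast

text \<open>Term-generatedness turns a valuation into a substitution: each value
  \<open>\<beta> x\<close> is named by a ground term of the sort of \<open>x\<close>. The assumption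
  on sorts places \<open>\<beta> x\<close> in a carrier to which this applies.\<close>

lemma is_model_valid:
  assumes N: "is_model S I N" "C \<in> N" and vars: "\<And>x. x \<in> vars_cls C \<Longrightarrow> var_sort x \<in> sorts S"
  shows "valid S I C"
  unfolding valid_def
proof (intro allI impI)
  fix \<beta> assume \<beta>: "valuation S I \<beta>"
  have "\<exists>t. gnd_trm S t \<and> trm_sort S t = var_sort x \<and> \<beta> x = eval_trm I t" if "x \<in> vars_cls C" for x
  proof -
    have "\<beta> x \<in> carr I (var_sort x)" using \<beta> vars[OF that] by (simp add: valuation_def)
    moreover have "carr I (var_sort x) =
        {eval_trm I t | t. gnd_trm S t \<and> trm_sort S t = var_sort x}"
      using N(1) vars[OF that] by (simp add: is_model_def term_generated_def)
    ultimately show ?thesis by blast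
  qed
  then obtain \<sigma> where \<sigma>: "\<And>x. x \<in> vars_cls C \<Longrightarrow>
      gnd_trm S (\<sigma> x) \<and> trm_sort S (\<sigma> x) = var_sort x \<and> \<beta> x = eval_trm I (\<sigma> x)"
    by metis
  then have "C \<cdot>c \<sigma> \<in> gnd_insts S C" by (auto simp: gnd_insts_def)
  then have "sat_gnd_cls I (C \<cdot>c \<sigma>)" using N by (auto simp: is_model_def)
  then have "cls_holds (val I (\<lambda>x. val I (\<lambda>_. undefined) (\<sigma> x))) C"
    by (simp add: sat_gnd_cls_val cls_holds_subst val_subst)
  then show "cls_holds (val I \<beta>) C"
    using \<sigma> by (subst cls_holds_val_cong[where \<gamma> = "\<lambda>x. val I (\<lambda>_. undefined) (\<sigma> x)" and J = I])
      (auto simp: eval_trm_val)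
qed


section \<open>Well-formedness\<close>

lemma wf_cls_vars:
  assumes "wf_cls H C" "x \<in> vars_cls C"
  shows "wf_trm H (Var x)"
proof -
  have "well_sorted S t \<Longrightarrow> x \<in> vars_trm t \<Longrightarrow> var_sort x \<in> sorts S" for S :: "('a, 'b) sig" and t
    by (induction t) auto
  then show ?thesis using assms by (fastforce simp: wf_cls_def vars_cls_def wf_trm_def)
qed

lemma wf_trm_Fun_arg: "wf_trm H (Fun f ts) \<Longrightarrow> t \<in> set ts \<Longrightarrow> wf_trm H t"
  by (auto simp: wf_trm_def)

lemma wf_trm_subst:
  assumes "wf_subst H \<sigma>"
  shows "wf_trm H t \<Longrightarrow> wf_trm H (t \<cdot> \<sigma>) \<and> trm_sort (full_sig H) (t \<cdot> \<sigma>) = trm_sort (full_sig H) t"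
proof (induction t)
  case (Var x)
  then show ?case using assms by (simp add: wf_subst_def)
next
  case (Fun f ts)
  have *: "wf_trm H (t \<cdot> \<sigma>) \<and> trm_sort (full_sig H) (t \<cdot> \<sigma>) = trm_sort (full_sig H) t"
    if "t \<in> set ts" for t
    using Fun.IH[OF that wf_trm_Fun_arg[OF Fun.prems that]] .
  then have "map (trm_sort (full_sig H)) (map (\<lambda>t. t \<cdot> \<sigma>) ts) = map (trm_sort (full_sig H)) ts"
    by simp
  then show ?case using Fun.prems * by (auto simp: wf_trm_def simp del: map_map)
qed

lemma wf_cls_subst:
  assumes "wf_subst H \<sigma>" "wf_cls H C"
  shows "wf_cls H (C \<cdot>c \<sigma>)"
  unfolding wf_cls_def
proof
  fix L assume "L \<in># C \<cdot>c \<sigma>"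
  then obtain L' where L': "L' \<in># C" "L = L' \<cdot>l \<sigma>" by (auto simp: subst_cls_def)
  then obtain \<xi> where "\<forall>t\<in>set_lit L'. wf_trm H t \<and> trm_sort (full_sig H) t = \<xi>"
    using assms(2) unfolding wf_cls_def by blast
  then have "\<forall>t\<in>set_lit L. wf_trm H t \<and> trm_sort (full_sig H) t = \<xi>"
    using wf_trm_subst[OF assms(1)] L'(2) by (auto simp: set_subst_lit)
  then show "\<exists>\<xi>. \<forall>t\<in>set_lit L. wf_trm H t \<and> trm_sort (full_sig H) t = \<xi>" ..
qed

lemma wf_cls_add_Upair:
  assumes "K \<in> {Pos, Neg}"
  shows "wf_cls H (add_mset (K (Upair s t)) C) \<longleftrightarrow>
    wf_trm H s \<and> wf_trm H t \<and> trm_sort (full_sig H) s = trm_sort (full_sig H) t \<and> wf_cls H C"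
  using assms by (auto simp: wf_cls_def)

lemma wf_trm_ctxt:
  assumes "wf_trm H (c\<langle>s\<rangle>)"
  shows "wf_trm H s"
  using assms by (induction c) (auto simp: wf_trm_def)

lemma wf_trm_ctxt_replace:
  assumes "wf_trm H (c\<langle>s\<rangle>)" "wf_trm H t" "trm_sort (full_sig H) s = trm_sort (full_sig H) t"
  shows "wf_trm H (c\<langle>t\<rangle>) \<and> trm_sort (full_sig H) (c\<langle>t\<rangle>) = trm_sort (full_sig H) (c\<langle>s\<rangle>)"
  using assms
proof (induction c)
  case (More f ss c ts)
  then have "wf_trm H (c\<langle>t\<rangle>) \<and> trm_sort (full_sig H) (c\<langle>t\<rangle>) = trm_sort (full_sig H) (c\<langle>s\<rangle>)"
    using wf_trm_Fun_arg by fastforce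
  then show ?case using More.prems(1) by (auto simp: wf_trm_def)
qed simp

section \<open>The background signature inside the full signature\<close>

lemma trm_sort_bg_sig [simp]: "trm_sort (bg_sig H) t = trm_sort (full_sig H) t"
  by (cases t) (simp_all add: bg_sig_def)

lemma bg_sig_simps [simp]:
  "sorts (bg_sig H) = bg_sorts H" "ops (bg_sig H) = bg_ops H"
  "arg_sorts (bg_sig H) = arg_sorts (full_sig H)" "res_sort (bg_sig H) = res_sort (full_sig H)"
  by (simp_all add: bg_sig_def)

lemma hierarchic_spec_sigs:
  assumes "hierarchic_spec H"
  shows "wf_sig (bg_sig H)" "bg_sorts H \<subseteq> sorts (full_sig H)" "bg_ops H \<subseteq> ops (full_sig H)"
    "params H \<subseteq> bg_ops H" "\<forall>c\<in>dom_elems H \<union> params H. arg_sorts (full_sig H) c = []"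
proof -
  note H = assms[unfolded hierarchic_spec_def]
  show "wf_sig (bg_sig H)" using H by (elim conjE)
  show "bg_sorts H \<subseteq> sorts (full_sig H)" using H by (elim conjE)
  show "bg_ops H \<subseteq> ops (full_sig H)" using H by (elim conjE)
  show "params H \<subseteq> bg_ops H" using H by (elim conjE)
  show "\<forall>c\<in>dom_elems H \<union> params H. arg_sorts (full_sig H) c = []" using H by (elim conjE)
qed

lemma bg_models_interp:
  assumes "hierarchic_spec H" "I \<in> bg_models H"
  shows "interpretation_of (bg_sig H) I" "term_generated (bg_sig H) I"
proof -
  have "\<forall>I\<in>bg_models H. interpretation_of (bg_sig H) I \<and> term_generated (bg_sig H) I"
    using assms(1) unfolding hierarchic_spec_def by (elim conjE)
  then show "interpretation_of (bg_sig H) I" "term_generated (bg_sig H) I"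
    using assms(2) by blast+
qed

lemma well_sorted_bg_full:
  assumes H: "hierarchic_spec H"
  shows "well_sorted (bg_sig H) t \<Longrightarrow> well_sorted (full_sig H) t"
proof (induction t)
  case (Fun f ts)
  moreover have "map (trm_sort (bg_sig H)) ts = map (trm_sort (full_sig H)) ts" by simp
  ultimately show ?case using hierarchic_spec_sigs(3)[OF H] by auto
qed (use hierarchic_spec_sigs(2)[OF H] in auto)

lemma bg_trm_sort:
  assumes "hierarchic_spec H" "bg_trm H t"
  shows "trm_sort (full_sig H) t \<in> bg_sorts H"
  using assms hierarchic_spec_sigs(1)[OF assms(1)] by (cases t) (auto simp: bg_trm_def wf_sig_def)

lemma gnd_bg_full: "hierarchic_spec H \<Longrightarrow> gnd_trm (bg_sig H) t \<Longrightarrow> gnd_trm (full_sig H) t"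
  by (auto simp: gnd_trm_def well_sorted_bg_full)

lemma gnd_wf_trm: "gnd_trm (full_sig H) t \<Longrightarrow> wf_trm H t"
  by (simp add: gnd_trm_def wf_trm_def)

lemma well_sorted_ops: "well_sorted S t \<Longrightarrow> ops_trm t \<subseteq> ops S"
  by (induction t) auto

lemma val_reduct: "well_sorted S t \<Longrightarrow> val (reduct S I) \<beta> t = val I \<beta> t"
  using well_sorted_ops[of S t] by (intro val_cong) (auto simp: reduct_def)

lemma eval_reduct: "well_sorted S t \<Longrightarrow> eval_trm (reduct S I) t = eval_trm I t"
  by (simp add: eval_trm_val val_reduct)

lemma sat_reduct_bg: "bg_cls H C \<Longrightarrow> sat_gnd_cls (reduct (bg_sig H) I) C = sat_gnd_cls I C"
  unfolding sat_gnd_cls_val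
  by (intro cls_holds_cong val_reduct) (auto simp: bg_cls_def bg_trm_def)

lemma valid_subst:
  assumes I: "interpretation_of (full_sig H) I" and \<sigma>: "wf_subst H \<sigma>"
    and C: "wf_cls H C" "valid (full_sig H) I C"
  shows "valid (full_sig H) I (C \<cdot>c \<sigma>)"
  unfolding valid_def
proof (intro allI impI)
  fix \<beta> assume \<beta>: "valuation (full_sig H) I \<beta>"
  \<comment> \<open>\<open>wf_subst\<close> controls \<open>\<sigma>\<close> only on well-formed
    variables, and an abstraction variable of a foreground sort is not one; at such variables
    \<open>\<beta>\<close> keeps the value in its carrier.\<close>
  define \<gamma> where "\<gamma> = (\<lambda>x. if wf_trm H (Var x) then val I \<beta> (\<sigma> x) else \<beta> x)"
  have "valuation (full_sig H) I \<gamma>"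
    unfolding valuation_def
  proof (intro allI impI)
    fix x assume x: "var_sort x \<in> sorts (full_sig H)"
    show "\<gamma> x \<in> carr I (var_sort x)"
    proof (cases "wf_trm H (Var x)")
      case True
      then have "well_sorted (full_sig H) (\<sigma> x)" "trm_sort (full_sig H) (\<sigma> x) = var_sort x"
        using \<sigma> by (auto simp: wf_subst_def wf_trm_def)
      then show ?thesis using val_in_carr[OF I \<beta>, of "\<sigma> x"] True by (simp add: \<gamma>_def)
    next
      case False
      then show ?thesis using \<beta> x by (simp add: \<gamma>_def valuation_def)
    qed
  qed
  then have "cls_holds (val I \<gamma>) C" using C(2) by (simp add: valid_def)
  then have "cls_holds (val I (\<lambda>x. val I \<beta> (\<sigma> x))) C"
    using wf_cls_vars[OF C(1)]
    by (subst cls_holds_val_cong[where \<gamma> = \<gamma> and J = I]) (auto simp: \<gamma>_def)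
  then show "cls_holds (val I \<beta>) (C \<cdot>c \<sigma>)" by (simp add: cls_holds_subst val_subst)
qed

text \<open>Superposition works on renamed premises; since renamings keep sorts and kinds, these are
  again instances by a well-formed substitution.\<close>

lemma variant_wf_subst:
  assumes "variant C C'"
  obtains \<sigma> where "wf_subst H \<sigma>" "C' = C \<cdot>c \<sigma>"
proof -
  obtain \<rho> where \<rho>: "\<forall>x. var_sort (\<rho> x) = var_sort x \<and> (is_abstr_var (\<rho> x) \<longleftrightarrow> is_abstr_var x)"
    "C' = C \<cdot>c (\<lambda>x. Var (\<rho> x))"
    using assms by (auto simp: variant_def)
  then have "wf_subst H (\<lambda>x. Var (\<rho> x))" by (auto simp: wf_subst_def wf_trm_def)
  then show thesis using that \<rho>(2) by blast
qed


section \<open>Weak abstraction\<close>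

text \<open>Either \<open>x\<close> has the value of \<open>q\<close>, and the replacement changes
  no value, or the new literal \<open>Var x !\<approx> q\<close> is true.\<close>

lemma valid_abstr_step:
  assumes "abstr_step H C C'" "valid S I C"
  shows "valid S I C'"
  using assms(1)
proof cases
  case (1 K c f ss q ts t D x n)
  show ?thesis
    unfolding valid_def
  proof (intro allI impI)
    fix \<beta> assume "valuation S I \<beta>"
    then have C: "cls_holds (val I \<beta>) C" using assms(2) by (simp add: valid_def)
    show "cls_holds (val I \<beta>) C'"
    proof (cases "val I \<beta> q = \<beta> x")
      case True
      then have "val I \<beta> (c\<langle>Fun f (ss @ q # ts)\<rangle>) = val I \<beta> (c\<langle>Fun f (ss @ Var x # ts)\<rangle>)"
        by (intro val_ctxt) simp
      then have "lit_holds (val I \<beta>) (K (Upair (c\<langle>Fun f (ss @ Var x # ts)\<rangle>) t)) \<longleftrightarrow>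
          lit_holds (val I \<beta>) (K (Upair (c\<langle>Fun f (ss @ q # ts)\<rangle>) t))"
        using 1(3) by (elim insertE emptyE) (simp_all only: lit_holds_Upair)
      then show ?thesis using C unfolding 1(1,2) by auto
    qed (simp add: 1(1))
  qed
qed

text \<open>Updating the valuation at the fresh variable makes the new literal false and gives the
  replaced term its former value.\<close>

lemma valid_abstr_step_rev:
  assumes H: "hierarchic_spec H" and I: "interpretation_of (full_sig H) I"
    and step: "abstr_step H C C'" and C': "valid (full_sig H) I C'"
  shows "valid (full_sig H) I C"
  using step
proof cases
  case (1 K c f ss q ts t D x n)
  show ?thesis
    unfolding valid_def
  proof (intro allI impI)
    fix \<beta> assume \<beta>: "valuation (full_sig H) I \<beta>"
    define \<gamma> where "\<gamma> = \<beta>(x := val I \<beta> q)"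
    have q: "well_sorted (full_sig H) q"
      using 1(4) well_sorted_bg_full[OF H] by (simp add: target_def bg_trm_def)
    have "var_sort x = trm_sort (full_sig H) q" using 1(5) by auto
    then have "valuation (full_sig H) I \<gamma>"
      using \<beta> val_in_carr[OF I \<beta> q] by (auto simp: valuation_def \<gamma>_def)
    then have C'_holds: "cls_holds (val I \<gamma>) C'" using C' by (simp add: valid_def)
    have "vars_trm q \<subseteq> vars_trm (c\<langle>Fun f (ss @ q # ts)\<rangle>)" by (induction c) auto
    \<comment> \<open>Freshness of \<open>x\<close> acts twice: here the update must not disturb the
      value of \<open>q\<close> from which it was taken, and at the end it must not affect the truth
      of \<open>C\<close>.\<close>
    then have "x \<notin> vars_trm q" using 1(2,3,6) by (auto simp: vars_cls_def)
    then have "val I \<gamma> q = val I \<beta> q" by (intro val_cong) (auto simp: \<gamma>_def)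
    then have eq: "val I \<gamma> q = \<gamma> x" by (simp add: \<gamma>_def)
    have "val I \<gamma> (c\<langle>Fun f (ss @ Var x # ts)\<rangle>) = val I \<gamma> (c\<langle>Fun f (ss @ q # ts)\<rangle>)"
      by (rule val_ctxt) (simp add: eq)
    then have "lit_holds (val I \<gamma>) (K (Upair (c\<langle>Fun f (ss @ Var x # ts)\<rangle>) t)) \<longleftrightarrow>
        lit_holds (val I \<gamma>) (K (Upair (c\<langle>Fun f (ss @ q # ts)\<rangle>) t))"
      using 1(3) by (elim insertE emptyE) (simp_all only: lit_holds_Upair)
    then have "cls_holds (val I \<gamma>) C"
      using C'_holds eq unfolding 1(1,2) by simp
    then show "cls_holds (val I \<beta>) C"
      using 1(6) by (subst cls_holds_val_cong[where \<gamma> = \<gamma> and J = I]) (auto simp: \<gamma>_def)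
  qed
qed

lemma valid_abstr:
  assumes "is_abstr H C C'" "valid S I C"
  shows "valid S I C'"
proof -
  have "(abstr_step H)\<^sup>*\<^sup>* C C'" using assms(1) by (simp add: is_abstr_def)
  then show ?thesis using assms(2)
  proof induction
    case (step D E)
    show ?case by (rule valid_abstr_step[OF step.hyps(2) step.IH[OF step.prems]])
  qed
qed

lemma valid_abstr_rev:
  assumes "hierarchic_spec H" "interpretation_of (full_sig H) I"
    and "is_abstr H C C'" "valid (full_sig H) I C'"
  shows "valid (full_sig H) I C"
proof -
  have "(abstr_step H)\<^sup>*\<^sup>* C C'" using assms(3) by (simp add: is_abstr_def)
  then show ?thesis using assms(4)
  proof (induction rule: converse_rtranclp_induct)
    case (step D E)
    show ?case by (rule valid_abstr_step_rev[OF assms(1,2) step.hyps(1) step.IH[OF step.prems]])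
  qed
qed

lemma wf_abstr_step:
  assumes H: "hierarchic_spec H" and step: "abstr_step H C C'" and C: "wf_cls H C"
  shows "wf_cls H C'"
  using step
proof cases
  case (1 K c f ss q ts t D x n)
  let ?c = "c\<langle>Fun f (ss @ q # ts)\<rangle>" and ?c' = "c\<langle>Fun f (ss @ Var x # ts)\<rangle>"
  have "bg_trm H q" using 1(4) by (simp add: target_def)
  note sort_q = bg_trm_sort[OF H this]
  have c: "wf_trm H ?c" using C 1(2,3) wf_cls_add_Upair by blast
  then have f: "wf_trm H (Fun f (ss @ q # ts))" by (rule wf_trm_ctxt)
  then have q: "wf_trm H q" by (rule wf_trm_Fun_arg) simp
  have "trm_sort (full_sig H) q \<in> sorts (full_sig H)"
    using sort_q hierarchic_spec_sigs(2)[OF H] by auto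
  then have x: "wf_trm H (Var x)" "var_sort x = trm_sort (full_sig H) q"
    using 1(5) sort_q by (auto simp: wf_trm_def)
  have "wf_trm H (Fun f (ss @ Var x # ts))" using f x by (auto simp: wf_trm_def)
  then have "wf_trm H ?c' \<and> trm_sort (full_sig H) ?c' = trm_sort (full_sig H) ?c"
    using wf_trm_ctxt_replace[OF c] by simp
  moreover have "wf_cls H D" using C 1(2,3) wf_cls_add_Upair by blast
  then have "wf_cls H (add_mset (Var x !\<approx> q) D)"
    using x q by (simp add: wf_cls_add_Upair[of Neg])
  ultimately show ?thesis
    using C unfolding 1(1,2) wf_cls_add_Upair[OF 1(3)] by simp
qed

lemma wf_abstr:
  assumes H: "hierarchic_spec H" and "is_abstr H C C'" "wf_cls H C"
  shows "wf_cls H C'"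
proof -
  have "(abstr_step H)\<^sup>*\<^sup>* C C'" using assms(2) by (simp add: is_abstr_def)
  then show ?thesis using assms(3)
  proof induction
    case (step D E)
    show ?case by (rule wf_abstr_step[OF H step.hyps(2) step.IH[OF step.prems]])
  qed
qed


section \<open>Soundness of the base rules\<close>

text \<open>With this, a model of the premises yields a background model that the side condition of
  Close excludes. Ground background instances are also instances over the full signature, and they
  are built from operators that the reduct keeps.\<close>

lemma close_sound:
  assumes H: "hierarchic_spec H"
    and I: "is_model (full_sig H) I N" "reduct (bg_sig H) I \<in> bg_models H"
    and M: "M \<subseteq> N" "\<And>C. C \<in> M \<Longrightarrow> bg_cls H C"
  shows "is_model (bg_sig H) (reduct (bg_sig H) I) M"
proof -
  have "sat_gnd_cls (reduct (bg_sig H) I) C'" if C: "C \<in> M" and C': "C' \<in> gnd_insts (bg_sig H) C" for C C'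
  proof -
    obtain \<sigma> where \<sigma>: "C' = C \<cdot>c \<sigma>"
      "\<And>x. x \<in> vars_cls C \<Longrightarrow> gnd_trm (bg_sig H) (\<sigma> x) \<and> trm_sort (bg_sig H) (\<sigma> x) = var_sort x"
      using C' by (auto simp: gnd_insts_def)
    have "C' \<in> gnd_insts (full_sig H) C"
      using \<sigma> gnd_bg_full[OF H] by (auto simp: gnd_insts_def)
    then have sat: "sat_gnd_cls I C'" using C M(1) I(1) by (auto simp: is_model_def)
    have subst: "well_sorted (bg_sig H) (t \<cdot> \<sigma>) \<and> trm_sort (bg_sig H) (t \<cdot> \<sigma>) = trm_sort (bg_sig H) t"
      if "well_sorted (bg_sig H) t" "vars_trm t \<subseteq> vars_cls C" for t
      using that
    proof (induction t)
      case (Var x)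
      then show ?case using \<sigma>(2) by (simp add: gnd_trm_def)
    next
      case (Fun f ts)
      then have *: "well_sorted (bg_sig H) (t \<cdot> \<sigma>) \<and> trm_sort (bg_sig H) (t \<cdot> \<sigma>) = trm_sort (bg_sig H) t"
        if "t \<in> set ts" for t
        using that by (simp add: UN_subset_iff)
      then have "map (trm_sort (bg_sig H)) (map (\<lambda>t. t \<cdot> \<sigma>) ts) = map (trm_sort (bg_sig H)) ts"
        by simp
      then show ?case using Fun.prems * by (auto simp del: trm_sort_bg_sig map_map)
    qed
    have "bg_cls H C'"
      unfolding bg_cls_def
    proof (intro ballI)
      fix L' t' assume "L' \<in># C'" "t' \<in> set_lit L'"
      then obtain L t where t: "L \<in># C" "t \<in> set_lit L" "t' = t \<cdot> \<sigma>"
        by (auto simp: \<sigma>(1) subst_cls_def set_subst_lit)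
      then have "well_sorted (bg_sig H) t" using M(2)[OF C] by (auto simp: bg_cls_def bg_trm_def)
      moreover have "vars_trm t \<subseteq> vars_cls C" using t by (auto simp: vars_cls_def)
      ultimately show "bg_trm H t'" using subst t(3) by (simp add: bg_trm_def)
    qed
    then show ?thesis using sat by (simp add: sat_reduct_bg)
  qed
  then show ?thesis using bg_models_interp[OF H I(2)] by (auto simp: is_model_def)
qed

text \<open>After the unifier has been applied, a single valuation serves all premises, so every
  case except Close is propositional reasoning plus congruence.\<close>

lemma hsp_base_sound:
  assumes H: "hierarchic_spec H" and wf: "\<And>C. C \<in> N \<Longrightarrow> wf_cls H C"
    and I: "is_model (full_sig H) I N" "reduct (bg_sig H) I \<in> bg_models H"
    and inf: "hsp_base H lt sel N E"
  shows "is_model (full_sig H) I {E}"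
proof -
  let ?S = "full_sig H"
  have interp: "interpretation_of ?S I" "term_generated ?S I" using I(1) by (auto simp: is_model_def)
  have premise: "valid ?S I C" if "C \<in> N" for C
    using is_model_valid[OF I(1) that] wf_cls_vars[OF wf[OF that]] by (auto simp: wf_trm_def)
  have inst: "valid ?S I (C \<cdot>c \<sigma>)" if "C \<in> N" "simple_mgu H V \<sigma> s t" for C \<sigma> V s t
    using valid_subst[OF interp(1) _ wf premise] that by (auto simp: simple_mgu_def simple_subst_def)
  have variant_inst: "valid ?S I (Q \<cdot>c \<sigma>)" if C: "C \<in> N" "variant C Q" and \<sigma>: "simple_mgu H V \<sigma> s t"
    for C Q \<sigma> V s t
  proof -
    obtain \<rho> where \<rho>: "wf_subst H \<rho>" "Q = C \<cdot>c \<rho>" using variant_wf_subst[OF C(2)] .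
    show ?thesis
      using valid_subst[OF interp(1) _ wf_cls_subst[OF \<rho>(1) wf[OF C(1)]]
          valid_subst[OF interp(1) \<rho>(1) wf[OF C(1)] premise[OF C(1)]]] \<sigma> \<rho>(2)
      by (auto simp: simple_mgu_def simple_subst_def)
  qed
  have abstr: "is_model ?S I {E}" if "is_abstr H C E"
    "\<And>\<beta>. valuation ?S I \<beta> \<Longrightarrow> cls_holds (val I \<beta>) C" for C
    using that valid_abstr[OF that(1), of ?S I] by (intro valid_is_model[OF interp]) (auto simp: valid_def)
  show ?thesis
    using inf
  proof cases
    case (equality_resolution P s t C \<sigma>)
    have eq: "s \<cdot> \<sigma> = t \<cdot> \<sigma>" using equality_resolution(6) by (simp add: simple_mgu_def)
    show ?thesis
    proof (rule abstr[OF equality_resolution(8)])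
      fix \<beta> assume "valuation ?S I \<beta>"
      then have "cls_holds (val I \<beta>) (P \<cdot>c \<sigma>)"
        by (rule validD[OF inst[OF equality_resolution(1,6)]])
      then show "cls_holds (val I \<beta>) (C \<cdot>c \<sigma>)"
        by (simp add: equality_resolution(3) cls_holds_subst eq)
    qed
  next
    case (negative_superposition P1 P2 Q1 Q2 l r C c u t D \<sigma>)
    note mgu = negative_superposition(13)
    have eq: "l \<cdot> \<sigma> = u \<cdot> \<sigma>" using mgu by (simp add: simple_mgu_def)
    show ?thesis
    proof (rule abstr[OF negative_superposition(19)])
      fix \<beta> assume \<beta>: "valuation ?S I \<beta>"
      have "cls_holds (val I \<beta>) (Q1 \<cdot>c \<sigma>)" "cls_holds (val I \<beta>) (Q2 \<cdot>c \<sigma>)"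
        by (rule validD[OF variant_inst[OF negative_superposition(1,5) mgu] \<beta>]
          validD[OF variant_inst[OF negative_superposition(2,6) mgu] \<beta>])+
      \<comment> \<open>\<open>val_subst\<close> moves \<open>\<sigma>\<close> into the valuation,
        so the context stays uninstantiated and congruence in contexts applies directly.\<close>
      moreover have "val I \<beta> (c\<langle>u\<rangle> \<cdot> \<sigma>) = val I \<beta> (c\<langle>r\<rangle> \<cdot> \<sigma>)" if "val I \<beta> (l \<cdot> \<sigma>) = val I \<beta> (r \<cdot> \<sigma>)"
        using that unfolding eq val_subst by (rule val_ctxt)
      ultimately show "cls_holds (val I \<beta>) (add_mset (c\<langle>r\<rangle> !\<approx> t) (C + D) \<cdot>c \<sigma>)"
        unfolding negative_superposition(8,9) cls_holds_subst cls_holds_simps lit_holds_Upair by argo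
    qed
  next
    case (positive_superposition P1 P2 Q1 Q2 l r C c u t D \<sigma>)
    note mgu = positive_superposition(13)
    have eq: "l \<cdot> \<sigma> = u \<cdot> \<sigma>" using mgu by (simp add: simple_mgu_def)
    show ?thesis
    proof (rule abstr[OF positive_superposition(20)])
      fix \<beta> assume \<beta>: "valuation ?S I \<beta>"
      have "cls_holds (val I \<beta>) (Q1 \<cdot>c \<sigma>)" "cls_holds (val I \<beta>) (Q2 \<cdot>c \<sigma>)"
        by (rule validD[OF variant_inst[OF positive_superposition(1,5) mgu] \<beta>]
          validD[OF variant_inst[OF positive_superposition(2,6) mgu] \<beta>])+
      moreover have "val I \<beta> (c\<langle>u\<rangle> \<cdot> \<sigma>) = val I \<beta> (c\<langle>r\<rangle> \<cdot> \<sigma>)" if "val I \<beta> (l \<cdot> \<sigma>) = val I \<beta> (r \<cdot> \<sigma>)"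
        using that unfolding eq val_subst by (rule val_ctxt)
      ultimately show "cls_holds (val I \<beta>) (add_mset (c\<langle>r\<rangle> \<approx> t) (C + D) \<cdot>c \<sigma>)"
        unfolding positive_superposition(8,9) cls_holds_subst cls_holds_simps lit_holds_Upair by argo
    qed
  next
    case (equality_factoring P s t l r C \<sigma>)
    have eq: "s \<cdot> \<sigma> = l \<cdot> \<sigma>" using equality_factoring(6) by (simp add: simple_mgu_def)
    show ?thesis
    proof (rule abstr[OF equality_factoring(11)])
      fix \<beta> assume "valuation ?S I \<beta>"
      then have "cls_holds (val I \<beta>) (P \<cdot>c \<sigma>)"
        by (rule validD[OF inst[OF equality_factoring(1,6)]])
      then show "cls_holds (val I \<beta>) (add_mset (l \<approx> r) (add_mset (t !\<approx> r) C) \<cdot>c \<sigma>)"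
        unfolding equality_factoring(3) cls_holds_subst cls_holds_simps lit_holds_Upair eq by argo
    qed
  next
    case (close M)
    then show ?thesis using close_sound[OF H I, of M] I(2) by blast
  qed
qed


section \<open>Unabstraction\<close>

text \<open>Traces a literal used for an instantiation back to the original clause, where a
  valuation that falsifies part of that clause says something about it.\<close>

lemma unabstr_run_lits:
  "unabstr_run C \<sigma> C' \<Longrightarrow> L' \<in># C' \<Longrightarrow> \<exists>L\<in>#C. L' = L \<cdot>l \<sigma>"
proof (induction arbitrary: L' rule: unabstr_run.induct)
  case init
  then show ?case by (auto simp: subst_lit_def lit.map_ident)
next
  case (step \<sigma> z t D)
  then obtain M where "M \<in># D" "L' = M \<cdot>l Var(z := t)" by (auto simp: subst_cls_def)
  then show ?case using step.IH[of M] by (auto simp: subst_lit_comp)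
qed

text \<open>Both sides of a literal have the same sort, so each instantiation respects sorts.
  Simplicity cannot be expected: a run may replace an abstraction variable by an impure
  term.\<close>

lemma unabstr_run_wf:
  assumes "unabstr_run C \<sigma> C'" "wf_cls H C"
  shows "wf_cls H C' \<and> wf_subst H \<sigma>"
  using assms
proof (induction rule: unabstr_run.induct)
  case init
  then show ?case by (simp add: wf_subst_def)
next
  case (step \<sigma> z t D)
  then have wf: "wf_trm H t" "trm_sort (full_sig H) t = var_sort z" "wf_cls H D" "wf_subst H \<sigma>"
    using wf_cls_add_Upair[of Neg H "Var z" t D] by auto
  then have zt: "wf_subst H (Var(z := t))" by (simp add: wf_subst_def)
  then have "wf_subst H (\<sigma> \<odot> Var(z := t))"
    using wf(4) wf_trm_subst[OF zt] by (auto simp: wf_subst_def comp_subst_def)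
  then show ?case using wf_cls_subst[OF zt wf(3)] by simp
qed

lemma vars_subst_upd:
  "vars_trm (s \<cdot> Var(z := t)) = (if z \<in> vars_trm s then vars_trm s - {z} \<union> vars_trm t else vars_trm s)"
  by (auto simp: vars_subst_trm split: if_splits)

lemma subst_Fun_not_Var: "(\<forall>y. s \<noteq> Var y) \<Longrightarrow> s \<cdot> \<tau> \<noteq> Var x"
  by (cases s) auto

lemma ctxt_not_Var: "(\<forall>y. s \<noteq> Var y) \<Longrightarrow> c\<langle>s\<rangle> \<noteq> Var x"
  by (cases c) auto

lemma vars_ctxt_subst: "vars_trm (s \<cdot> \<sigma>) \<subseteq> vars_trm (c\<langle>s\<rangle> \<cdot> \<sigma>)"
  by (induction c) auto

text \<open>
  If the literals of \<open>D\<close> are false under \<open>\<beta>\<close>, the instantiations read off from \<open>D\<close> agree with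
  \<open>\<beta>\<close>.  The literal containing \<open>t\<close> may be true and nevertheless be used for an instantiation;
  but that puts \<open>t\<close> into a proper superterm, and the occurs check then prevents the affected
  variables from ever contributing to the instances of \<open>t\<close>.
\<close>

lemma unabstr_run_val:
  assumes run: "unabstr_run (add_mset (K (Upair (c\<langle>t\<rangle>) u)) D) \<sigma> C'"
    and K: "K \<in> {Pos, Neg}" and t: "\<forall>y. t \<noteq> Var y"
    and D: "\<not> cls_holds (val I \<beta>) D"
  shows "(\<forall>x. val I \<beta> (\<sigma> x) = \<beta> x \<or> (\<forall>y. \<sigma> x \<noteq> Var y) \<and> vars_trm (t \<cdot> \<sigma>) \<subseteq> vars_trm (\<sigma> x)) \<and>
    val I \<beta> (t \<cdot> \<sigma>) = val I \<beta> t"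
  using run
proof (induction rule: unabstr_run.induct)
  case init
  then show ?case by simp
next
  case (step \<sigma> z s E)
  let ?V = "vars_trm (t \<cdot> \<sigma>)"
  let ?good = "\<lambda>x. val I \<beta> (\<sigma> x) = \<beta> x"
  let ?big = "\<lambda>r. (\<forall>y. r \<noteq> Var y) \<and> ?V \<subseteq> vars_trm r"
  have alt: "?good x \<or> ?big (\<sigma> x)" for x using step.IH by blast
  have tval: "val I \<beta> (t \<cdot> \<sigma>) = val I \<beta> t" using step.IH by blast
  have upd: "(\<sigma> \<odot> Var(z := s)) x = \<sigma> x \<cdot> Var(z := s)" for x by (simp add: comp_subst_def)
  \<comment> \<open>The instantiation is either correct or harmless: in the last case
    \<open>z\<close> does not occur in the instance of \<open>t\<close>, so the step leaves that
    instance unchanged.\<close>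
  have "s = Var z \<or> val I \<beta> s = \<beta> z \<or> ?big s \<and> z \<notin> ?V"
  proof (cases "s = Var z")
    case False
    then have zs: "z \<notin> vars_trm s" using step.hyps by blast
    obtain M where M: "M \<in># add_mset (K (Upair (c\<langle>t\<rangle>) u)) D" "(Var z !\<approx> s) = M \<cdot>l \<sigma>"
      using unabstr_run_lits[OF step.hyps(1)] by (meson union_single_eq_member)
    then obtain A where A: "M = Neg A" "map_uprod (\<lambda>t. t \<cdot> \<sigma>) A = Upair (Var z) s"
      by (cases M) (auto simp: subst_lit_def)
    have "\<exists>p q. M = (p !\<approx> q) \<and> p \<cdot> \<sigma> = Var z \<and> q \<cdot> \<sigma> = s"
    proof (cases A)
      case (Upair p q)
      then have "p \<cdot> \<sigma> = Var z \<and> q \<cdot> \<sigma> = s \<or> q \<cdot> \<sigma> = Var z \<and> p \<cdot> \<sigma> = s"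
        using A(2) by auto
      then show ?thesis using A(1) Upair Upair_inject by metis
    qed
    then obtain p q where pq: "M = (p !\<approx> q)" "p \<cdot> \<sigma> = Var z" "q \<cdot> \<sigma> = s" by blast
    show ?thesis
    proof (cases "M \<in># D")
      case True
      then have eq: "val I \<beta> p = val I \<beta> q" using D pq(1) by (force simp: cls_holds_def)
      obtain y where y: "p = Var y" "\<sigma> y = Var z" using pq(2) by (cases p) auto
      \<comment> \<open>\<open>\<sigma> y\<close> is a variable, which rules out the second
        alternative of the invariant; this is the purpose of its non-variable condition.\<close>
      then have "?good y" using alt by blast
      then have z: "\<beta> z = val I \<beta> q" using y eq by simp
      show ?thesis
      proof (cases "\<forall>x\<in>vars_trm q. ?good x")
        case True
        then have "val I \<beta> (q \<cdot> \<sigma>) = val I \<beta> q"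
          unfolding val_subst by (intro val_cong) auto
        then show ?thesis using z pq(3) by simp
      next
        case False
        \<comment> \<open>One big component suffices: \<open>\<sigma> x\<close> is part of
          \<open>s\<close>, so \<open>s\<close> inherits all of \<open>?V\<close>, and the occurs
          check for \<open>z\<close> extends to \<open>?V\<close>.\<close>
        then obtain x where x: "x \<in> vars_trm q" "?big (\<sigma> x)" using alt by blast
        have "vars_trm (\<sigma> x) \<subseteq> vars_trm s"
          using x(1) vars_subst_trm[of q \<sigma>] pq(3) by blast
        then have "?V \<subseteq> vars_trm s" using x(2) by blast
        moreover have "\<forall>y. s \<noteq> Var y"
          using x pq(3) by (cases q) auto
        ultimately show ?thesis using zs by blast
      qed
    next
      case False
      then have "(p !\<approx> q) = K (Upair (c\<langle>t\<rangle>) u)" using M(1) pq(1) by auto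
      then have "Upair p q = Upair (c\<langle>t\<rangle>) u" using K by auto
      \<comment> \<open>The side containing \<open>t\<close> is no variable after instantiation, so
        it must be \<open>s\<close>, and \<open>z\<close> comes from the side
        \<open>u\<close>.\<close>
      moreover have nv: "c\<langle>t\<rangle> \<cdot> \<sigma> \<noteq> Var x" for x
        using subst_Fun_not_Var ctxt_not_Var t by metis
      ultimately have "s = c\<langle>t\<rangle> \<cdot> \<sigma>" using pq by auto
      then show ?thesis using nv vars_ctxt_subst[of t \<sigma> c] zs by auto
    qed
  qed simp
  then consider "s = Var z \<or> val I \<beta> s = \<beta> z" | "?big s" "z \<notin> ?V" by blast
  then show ?case
  proof cases
    case 1
    \<comment> \<open>A correct instantiation changes no value, and the second alternative is stable
      under every substitution.\<close>
    then have "(\<lambda>x. val I \<beta> ((Var(z := s)) x)) = \<beta>" by auto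
    then have val_upd: "val I \<beta> (r \<cdot> Var(z := s)) = val I \<beta> r" for r by (simp add: val_subst)
    have "?big (\<sigma> x) \<Longrightarrow> (\<forall>y. \<sigma> x \<cdot> Var(z := s) \<noteq> Var y) \<and>
        vars_trm (t \<cdot> \<sigma> \<cdot> Var(z := s)) \<subseteq> vars_trm (\<sigma> x \<cdot> Var(z := s))" for x
      using subst_Fun_not_Var[of "\<sigma> x"] by (auto simp: vars_subst_trm)
    then show ?thesis
      unfolding subst_comp unfolding upd val_upd using alt tval by blast
  next
    case 2
    have same: "r \<cdot> Var(z := s) = r" if "z \<notin> vars_trm r" for r
      using subst_trm_cong[of r "Var(z := s)" Var] that by (metis fun_upd_apply subst_trm_Var)
    \<comment> \<open>Variables whose instance contains \<open>z\<close> may get a wrong value here;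
      they move to the second alternative because \<open>s\<close> brings in all of
      \<open>?V\<close>.\<close>
    have "(\<forall>y. r \<cdot> Var(z := s) \<noteq> Var y) \<and> ?V \<subseteq> vars_trm (r \<cdot> Var(z := s))"
      if "z \<in> vars_trm r" for r
    proof
      show "?V \<subseteq> vars_trm (r \<cdot> Var(z := s))" using that 2 by (auto simp: vars_subst_upd)
      show "\<forall>y. r \<cdot> Var(z := s) \<noteq> Var y" using that 2 by (cases r) auto
    qed
    then have "?good x \<and> \<sigma> x \<cdot> Var(z := s) = \<sigma> x \<or> (\<forall>y. \<sigma> x \<cdot> Var(z := s) \<noteq> Var y) \<and>
        ?V \<subseteq> vars_trm (\<sigma> x \<cdot> Var(z := s))" for x
      using alt[of x] same[of "\<sigma> x"] by (cases "z \<in> vars_trm (\<sigma> x)") auto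
    then show ?thesis using tval same[OF 2(2)] by (metis upd subst_comp)
  qed
qed


section \<open>Soundness of Define\<close>

lemma define_replace_sound:
  assumes P: "valid S I (add_mset (K (Upair (c\<langle>t\<rangle>) u)) D)" and K: "K \<in> {Pos, Neg}"
    and t: "\<forall>y. t \<noteq> Var y"
    and t': "unabstracted_version (add_mset (K (Upair (c\<langle>t\<rangle>) u)) D) t t'"
    and a: "valid S I {#t' \<approx> Fun a []#}"
  shows "valid S I (add_mset (K (Upair (c\<langle>Fun a []\<rangle>) u)) D)"
  unfolding valid_def
proof (intro allI impI)
  fix \<beta> assume \<beta>: "valuation S I \<beta>"
  show "cls_holds (val I \<beta>) (add_mset (K (Upair (c\<langle>Fun a []\<rangle>) u)) D)"
  proof (cases "cls_holds (val I \<beta>) D")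
    case False
    obtain \<sigma> C' where \<sigma>: "unabstr_run (add_mset (K (Upair (c\<langle>t\<rangle>) u)) D) \<sigma> C'" "t' = t \<cdot> \<sigma>"
      using t' by (auto simp: unabstracted_version_def is_unabstr_def)
    have "val I \<beta> t' = val I \<beta> t" using unabstr_run_val[OF \<sigma>(1) K t False] \<sigma>(2) by simp
    moreover have "val I \<beta> t' = val I \<beta> (Fun a [])"
      using validD[OF a \<beta>] unfolding cls_holds_simps lit_holds_Upair by simp
    ultimately have "val I \<beta> (c\<langle>t\<rangle>) = val I \<beta> (c\<langle>Fun a []\<rangle>)" by (intro val_ctxt) simp
    then have "lit_holds (val I \<beta>) (K (Upair (c\<langle>t\<rangle>) u)) \<longleftrightarrow>
        lit_holds (val I \<beta>) (K (Upair (c\<langle>Fun a []\<rangle>) u))"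
      using K by (elim insertE emptyE) (simp_all only: lit_holds_Upair)
    then show ?thesis using validD[OF P \<beta>] by simp
  qed simp
qed

text \<open>Terms containing \<open>a\<close> may have been the only names of some elements, so the
  point is that \<open>J\<close> is still term-generated. For background sorts this comes from
  membership in \<open>bg_models H\<close>, in general by renaming terms inductively.\<close>

lemma param_update_model:
  fixes I :: "('f, 's, 'u) interp"
  assumes H: "hierarchic_spec H"
    and I: "interpretation_of (full_sig H) I" "term_generated (full_sig H) I"
      "reduct (bg_sig H) I \<in> bg_models H"
    and a: "a \<in> params H" and v: "v \<in> carr I (res_sort (full_sig H) a)"
  defines "J \<equiv> I\<lparr>op_fun := (op_fun I)(a := \<lambda>_. v)\<rparr>"
  shows "interpretation_of (full_sig H) J \<and> term_generated (full_sig H) J \<and>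
    reduct (bg_sig H) J \<in> bg_models H"
proof -
  let ?S = "full_sig H" and ?I = "reduct (bg_sig H) I" and ?J = "reduct (bg_sig H) J"
  note sigs = hierarchic_spec_sigs[OF H]
  have a_ops: "a \<in> bg_ops H" using a sigs(4) by blast
  then have a_sort: "res_sort ?S a \<in> bg_sorts H" using sigs(1) by (simp add: wf_sig_def)
  have carr_J: "carr J = carr I" by (simp add: J_def)
  have op_J: "op_fun J f = (if f = a then \<lambda>_. v else op_fun I f)" for f by (simp add: J_def)
  have interp: "interpretation_of ?S J"
    using I(1) v by (simp add: interpretation_of_def args_in_def carr_J op_J)
  have carr_bg: "carr ?J = carr ?I" by (simp add: reduct_def carr_J fun_eq_iff)
  have op_bg: "op_fun ?J f = (if f = a then \<lambda>_. v else op_fun ?I f)" for f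
    using a_ops by (auto simp: reduct_def op_J)
  have "v \<in> carr ?I (res_sort ?S a)" using v a_sort by (simp add: reduct_def)
  then have interp_bg: "interpretation_of (bg_sig H) ?J"
    using bg_models_interp(1)[OF H I(3)]
    by (simp add: interpretation_of_def args_in_def carr_bg op_bg)
  \<comment> \<open>The free choice of parameters asks only for an interpretation, so
    \<open>?J\<close> is known to belong to the class before anything is known about its being
    term-generated; membership then supplies that.\<close>
  have "\<forall>I\<in>bg_models H. \<forall>J. interpretation_of (bg_sig H) J \<and>
        (\<forall>\<xi>\<in>bg_sorts H. carr J \<xi> = carr I \<xi>) \<and>
        (\<forall>f\<in>bg_ops H - params H. \<forall>as. args_in (bg_sig H) I f as \<longrightarrow> op_fun J f as = op_fun I f as) \<longrightarrow>
        J \<in> bg_models H"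
    using H unfolding hierarchic_spec_def by (elim conjE)
  moreover have "\<forall>\<xi>\<in>bg_sorts H. carr ?J \<xi> = carr ?I \<xi>" by (simp add: carr_bg)
  moreover have "\<forall>f\<in>bg_ops H - params H. \<forall>as. args_in (bg_sig H) ?I f as \<longrightarrow> op_fun ?J f as = op_fun ?I f as"
    using a by (auto simp: op_bg)
  ultimately have bg: "?J \<in> bg_models H" using I(3) interp_bg by blast
  have bg_named: "\<exists>s. gnd_trm ?S s \<and> trm_sort ?S s = res_sort ?S a \<and> eval_trm J s = b"
    if b: "b \<in> carr I (res_sort ?S a)" for b
  proof -
    have "carr ?J (res_sort ?S a) = carr I (res_sort ?S a)"
      using a_sort by (simp add: reduct_def carr_J)
    moreover have "carr ?J (res_sort ?S a) =
        {eval_trm ?J t | t. gnd_trm (bg_sig H) t \<and> trm_sort ?S t = res_sort ?S a}"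
      using bg_models_interp(2)[OF H bg] a_sort by (simp add: term_generated_def)
    ultimately have "b \<in> {eval_trm ?J t | t. gnd_trm (bg_sig H) t \<and> trm_sort ?S t = res_sort ?S a}"
      using b by simp
    then obtain s where "gnd_trm (bg_sig H) s" "trm_sort ?S s = res_sort ?S a" "eval_trm ?J s = b"
      by blast
    then show ?thesis
      using gnd_bg_full[OF H] eval_reduct[of "bg_sig H" s J] by (auto simp: gnd_trm_def)
  qed
  \<comment> \<open>Each old value gets a new name: a subterm headed by \<open>a\<close> is
    exchanged for a term with its old value in \<open>J\<close>; all other operators are
    kept.\<close>
  have named: "\<exists>s. gnd_trm ?S s \<and> trm_sort ?S s = trm_sort ?S t \<and> eval_trm J s = eval_trm I t"
    if "gnd_trm ?S t" for t
    using that
  proof (induction t)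
    case (Var x)
    then show ?case by (simp add: gnd_trm_def)
  next
    case (Fun f ts)
    show ?case
    proof (cases "f = a")
      case True
      then show ?thesis using bg_named eval_in_carr[OF I(1) Fun.prems] by simp
    next
      case False
      have "\<exists>s. gnd_trm ?S s \<and> trm_sort ?S s = trm_sort ?S t \<and> eval_trm J s = eval_trm I t"
        if "t \<in> set ts" for t
        using Fun.IH[OF that] Fun.prems that by (simp add: gnd_trm_def)
      then obtain g where g: "\<And>t. t \<in> set ts \<Longrightarrow> gnd_trm ?S (g t) \<and>
          trm_sort ?S (g t) = trm_sort ?S t \<and> eval_trm J (g t) = eval_trm I t"
        by metis
      have "map (trm_sort ?S) (map g ts) = map (trm_sort ?S) ts"
        "map (eval_trm J) (map g ts) = map (eval_trm I) ts"
        using g by auto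
      then have "gnd_trm ?S (Fun f (map g ts))" "eval_trm J (Fun f (map g ts)) = eval_trm I (Fun f ts)"
        using Fun.prems g False by (auto simp: gnd_trm_def op_J simp del: map_map)
      then show ?thesis by (intro exI[of _ "Fun f (map g ts)"]) simp
    qed
  qed
  have "term_generated ?S J"
    unfolding term_generated_def
  proof (intro ballI equalityI subsetI)
    fix \<xi> b assume \<xi>: "\<xi> \<in> sorts ?S" and b: "b \<in> carr J \<xi>"
    then obtain t where "gnd_trm ?S t" "trm_sort ?S t = \<xi>" "b = eval_trm I t"
      using I(2) by (auto simp: term_generated_def carr_J)
    then show "b \<in> {eval_trm J t | t. gnd_trm ?S t \<and> trm_sort ?S t = \<xi>}"
      using named[of t] by force
  next
    fix \<xi> b assume "b \<in> {eval_trm J t | t. gnd_trm ?S t \<and> trm_sort ?S t = \<xi>}"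
    then show "b \<in> carr J \<xi>" using eval_in_carr[OF interp] by auto
  qed
  then show ?thesis using interp bg by blast
qed

lemma ops_subst_trm: "ops_trm (t \<cdot> \<sigma>) = ops_trm t \<union> (\<Union>x\<in>vars_trm t. ops_trm (\<sigma> x))"
  by (induction t) auto

text \<open>A run only recombines material of \<open>C\<close>; hence a parameter absent from the
  premise is also absent from the term it is to name.\<close>

lemma unabstr_run_ops:
  assumes "unabstr_run C \<sigma> C'"
  shows "ops_cls C' \<subseteq> ops_cls C \<and> (\<forall>x. ops_trm (\<sigma> x) \<subseteq> ops_cls C)"
  using assms
proof (induction rule: unabstr_run.induct)
  case init
  then show ?case by simp
next
  case (step \<sigma> z t D)
  then have t: "ops_trm t \<subseteq> ops_cls C" and D: "ops_cls D \<subseteq> ops_cls C"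
    by (auto simp: ops_cls_def)
  then have "ops_trm (s \<cdot> Var(z := t)) \<subseteq> ops_cls C" if "ops_trm s \<subseteq> ops_cls C" for s
    using that by (auto simp: ops_subst_trm split: if_splits)
  moreover have "ops_cls (D \<cdot>c Var(z := t)) \<subseteq> ops_cls D \<union> ops_trm t"
    by (auto simp: ops_cls_def subst_cls_def set_subst_lit ops_subst_trm split: if_splits)
  ultimately show ?case using step.IH D t by (simp add: comp_subst_def) blast
qed

lemma ops_ctxt: "ops_trm t \<subseteq> ops_trm (c\<langle>t\<rangle>)"
  by (induction c) auto

text \<open>
  The new definition is satisfied by reinterpreting the reserved parameter.  The model stays
  term-generated because the background specification leaves the parameters free and all its
  members are term-generated, so the old value of the parameter is still the value of some
  background term.
\<close>

lemma define_preserves_model: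
  fixes H :: "('f, 's, 'u) hspec"
  assumes H: "hierarchic_spec H" and rule: "define_rule H lt par N N'"
    and wf: "\<forall>C\<in>N. wf_cls H C"
    and I: "is_model (full_sig H) I N" "reduct (bg_sig H) I \<in> bg_models H"
  shows "\<exists>J. is_model (full_sig H) J N' \<and> reduct (bg_sig H) J \<in> bg_models H"
  using rule
proof cases
  case (1 P K c t u D t' a N0 E1 E2)
  let ?S = "full_sig H"
  have interp: "interpretation_of ?S I" "term_generated ?S I" using I(1) by (auto simp: is_model_def)
  have N_valid: "valid ?S I C" if "C \<in> N" for C
    using is_model_valid[OF I(1) that] wf_cls_vars[of H C] wf that by (auto simp: wf_trm_def)
  have P: "P \<in> N" using 1(1) by simp
  have t_nv: "\<forall>y. t \<noteq> Var y" using 1(6) by (auto simp: fg_headed_bg_sorted_def)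
  obtain \<sigma> C' where \<sigma>: "unabstr_run P \<sigma> C'" "t' = t \<cdot> \<sigma>"
    using 1(8) by (auto simp: unabstracted_version_def is_unabstr_def)
  have "wf_trm H (c\<langle>t\<rangle>)" using wf P 1(3) wf_cls_add_Upair[OF 1(4)] by blast
  then have t: "wf_trm H t" by (rule wf_trm_ctxt)
  have "wf_subst H \<sigma>" using unabstr_run_wf[OF \<sigma>(1)] wf P by blast
  then have t': "gnd_trm ?S t'"
    using wf_trm_subst[of H \<sigma> t] t \<sigma>(2) 1(9) by (simp add: gnd_trm_def wf_trm_def)
  \<comment> \<open>Once a model of the premises satisfies the definition, both new clauses follow;
    the two ways of being reserved differ only in how such a model is obtained.\<close>
  have extend: "\<exists>J. is_model ?S J N' \<and> reduct (bg_sig H) J \<in> bg_models H"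
    if J: "interpretation_of ?S J" "term_generated ?S J" "reduct (bg_sig H) J \<in> bg_models H"
      "\<And>C. C \<in> N \<Longrightarrow> valid ?S J C" and a: "valid ?S J {#t' \<approx> Fun a []#}"
    for J :: "('f, 's, 'u) interp"
  proof -
    have "valid ?S J (add_mset (K (Upair (c\<langle>Fun a []\<rangle>) u)) D)"
      using define_replace_sound[OF _ 1(4) t_nv _ a] J(4)[OF P] 1(8) unfolding 1(3) by blast
    then have "valid ?S J E2" by (rule valid_abstr[OF 1(15)])
    moreover have "valid ?S J E1" using a by (rule valid_abstr[OF 1(14)])
    ultimately have "is_model ?S J N'"
      using J(1,2,4) 1(1,2) by (intro valid_is_model) auto
    then show ?thesis using J(3) by blast
  qed
  show ?thesis
    using 1(13) unfolding reserved_def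
  proof
    assume fresh: "\<forall>C\<in>N0 \<union> {P}. a \<notin> ops_cls C"
    define J where "J = I\<lparr>op_fun := (op_fun I)(a := \<lambda>_. eval_trm I t')\<rparr>"
    have v: "eval_trm I t' \<in> carr I (res_sort ?S a)"
      using eval_in_carr[OF interp(1) t'] 1(12) by simp
    have J: "interpretation_of ?S J" "term_generated ?S J" "reduct (bg_sig H) J \<in> bg_models H"
      using param_update_model[OF H interp I(2) 1(11) v] unfolding J_def by blast+
    have op_J: "op_fun J f = op_fun I f" if "f \<noteq> a" for f using that by (simp add: J_def)
    have val_same: "valuation ?S J \<beta> = valuation ?S I \<beta>" for \<beta> by (simp add: valuation_def J_def)
    have J_valid: "valid ?S J C" if "C \<in> N" for C
    proof -
      have "a \<notin> ops_cls C" using fresh that 1(1) by blast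
      then have "cls_holds (val J \<beta>) C = cls_holds (val I \<beta>) C" for \<beta>
        by (intro cls_holds_val_cong op_J) auto
      then show ?thesis using N_valid[OF that] by (simp add: valid_def val_same)
    qed
    have a: "valid ?S J {#t' \<approx> Fun a []#}"
    proof -
      \<comment> \<open>If \<open>a\<close> occurred in \<open>t'\<close>, giving \<open>a\<close> a
        new value could alter the very value it is meant to equal.\<close>
      have "ops_trm t \<subseteq> ops_cls P"
        using ops_ctxt[of t c] 1(3,4) by (auto simp: ops_cls_def)
      then have "ops_trm t' \<subseteq> ops_cls P"
        using unabstr_run_ops[OF \<sigma>(1)] \<sigma>(2) by (auto simp: ops_subst_trm)
      then have "a \<notin> ops_trm t'" using fresh by blast
      then have "val J \<beta> t' = val I (\<lambda>_. undefined) t'" for \<beta>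
        using t' by (intro val_cong op_J) (auto simp: gnd_trm_def)
      then show ?thesis by (simp add: valid_def J_def eval_trm_val)
    qed
    show ?thesis by (rule extend[OF J _ a]) (rule J_valid)
  next
    assume "\<exists>E\<in>N0 \<union> {P}. is_abstr H {#t' \<approx> Fun a []#} E"
    then obtain E where "E \<in> N" "is_abstr H {#t' \<approx> Fun a []#} E" using 1(1) by blast
    \<comment> \<open>The earlier definition is present only in abstracted form, so its abstraction
      has to be reversed; \<open>I\<close> itself then serves as the model.\<close>
    then have a: "valid ?S I {#t' \<approx> Fun a []#}"
      using valid_abstr_rev[OF H interp(1)] N_valid by blast
    show ?thesis by (rule extend[OF interp I(2) _ a]) (rule N_valid)
  qed
qed

section \<open>Simple ground instances and redundancy\<close>

lemma sgi_gnd_insts: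
  assumes "wf_cls H C" "C' \<in> sgi H C"
  shows "C' \<in> gnd_insts (full_sig H) C \<and> vars_cls C' = {}"
proof -
  obtain \<sigma> where \<sigma>: "C' = C \<cdot>c \<sigma>" "simple_subst H \<sigma>" "vars_cls C' = {}"
    using assms(2) by (auto simp: sgi_def)
  have "gnd_trm (full_sig H) (\<sigma> x) \<and> trm_sort (full_sig H) (\<sigma> x) = var_sort x"
    if "x \<in> vars_cls C" for x
    using wf_cls_vars[OF assms(1) that] \<sigma> that
    by (auto simp: simple_subst_def wf_subst_def vars_subst_cls gnd_trm_def wf_trm_def)
  then show ?thesis using \<sigma>(1,3) by (auto simp: gnd_insts_def)
qed

text \<open>
  Simple ground instances suffice, since in a background model every element of a background
  carrier is the value of a ground background term.
\<close>

lemma valid_sgi: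
  assumes H: "hierarchic_spec H"
    and I: "interpretation_of (full_sig H) I" "term_generated (full_sig H) I"
      "reduct (bg_sig H) I \<in> bg_models H"
    and C: "wf_cls H C" "\<forall>C'\<in>sgi H C. sat_gnd_cls I C'"
  shows "valid (full_sig H) I C"
  unfolding valid_def
proof (intro allI impI)
  let ?S = "full_sig H"
  fix \<beta> assume \<beta>: "valuation ?S I \<beta>"
  have "\<exists>t. gnd_trm ?S t \<and> trm_sort ?S t = var_sort x \<and> \<beta> x = eval_trm I t \<and>
      (is_abstr_var x \<longrightarrow> bg_trm H t)" if x: "wf_trm H (Var x)" for x
  proof -
    have x_sort: "var_sort x \<in> sorts ?S" using x by (simp add: wf_trm_def)
    then have \<beta>x: "\<beta> x \<in> carr I (var_sort x)" using \<beta> by (simp add: valuation_def)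
    show ?thesis
    proof (cases "is_abstr_var x")
      case True
      then have bg: "var_sort x \<in> bg_sorts H" using x by (simp add: wf_trm_def)
      then have "\<beta> x \<in> carr (reduct (bg_sig H) I) (var_sort x)" using \<beta>x by (simp add: reduct_def)
      then obtain t where t: "gnd_trm (bg_sig H) t" "trm_sort ?S t = var_sort x"
        "\<beta> x = eval_trm (reduct (bg_sig H) I) t"
        using bg_models_interp(2)[OF H I(3)] bg by (auto simp: term_generated_def)
      then show ?thesis
        using gnd_bg_full[OF H] eval_reduct[of "bg_sig H" t I] by (auto simp: gnd_trm_def bg_trm_def)
    next
      case False
      then show ?thesis using I(2) x_sort \<beta>x by (auto simp: term_generated_def)
    qed
  qed
  \<comment> \<open>\<open>simple_subst\<close> speaks about all well-formed variables, so terms are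
    chosen for all of them and not just for those of \<open>C\<close>.\<close>
  then obtain \<sigma> where \<sigma>: "\<And>x. wf_trm H (Var x) \<Longrightarrow> gnd_trm ?S (\<sigma> x) \<and>
      trm_sort ?S (\<sigma> x) = var_sort x \<and> \<beta> x = eval_trm I (\<sigma> x) \<and> (is_abstr_var x \<longrightarrow> bg_trm H (\<sigma> x))"
    by metis
  have "wf_trm H (\<sigma> x)" if "wf_trm H (Var x)" for x
    using gnd_wf_trm[of H "\<sigma> x"] \<sigma>[OF that] by blast
  then have "simple_subst H \<sigma>"
    unfolding simple_subst_def wf_subst_def using \<sigma> by (auto simp: pure_bg_trm_def gnd_trm_def)
  moreover have "vars_cls (C \<cdot>c \<sigma>) = {}"
    using wf_cls_vars[OF C(1)] \<sigma> by (auto simp: vars_subst_cls gnd_trm_def)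
  ultimately have "sat_gnd_cls I (C \<cdot>c \<sigma>)" using C(2) by (auto simp: sgi_def)
  then have "cls_holds (val I (\<lambda>x. val I (\<lambda>_. undefined) (\<sigma> x))) C"
    by (simp add: sat_gnd_cls_val cls_holds_subst val_subst)
  then show "cls_holds (val I \<beta>) C"
    using \<sigma> wf_cls_vars[OF C(1)]
    by (subst cls_holds_val_cong[where \<gamma> = "\<lambda>x. val I (\<lambda>_. undefined) (\<sigma> x)" and J = I])
      (auto simp: eval_trm_val)
qed

text \<open>Redundant instances follow from simple ground instances of \<open>N\<close> and from
  \<open>GndTh H\<close>. The former hold in every model of \<open>N\<close>, the latter because the
  reduct of \<open>I\<close> is a background model.\<close>

lemma Red_H_sound:
  fixes H :: "('f, 's, 'u) hspec"
  assumes H: "hierarchic_spec H" and wf: "\<And>D. D \<in> N \<Longrightarrow> wf_cls H D"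
    and I: "is_model (full_sig H) I N" "reduct (bg_sig H) I \<in> bg_models H"
    and C: "C \<in> Red_H H lt N"
  shows "valid (full_sig H) I C"
proof -
  let ?S = "full_sig H" and ?M = "(\<Union>D\<in>N. sgi H D) \<union> GndTh H"
  have interp: "interpretation_of ?S I" "term_generated ?S I" using I(1) by (auto simp: is_model_def)
  have GndTh: "sat_gnd_cls I G" if "G \<in> GndTh H" for G
    using that I(2) sat_reduct_bg[of H G I] by (auto simp: GndTh_def)
  have M: "sat_gnd_cls I G \<and> vars_cls G = {}" if "G \<in> ?M" for G
    using that
  proof
    assume "G \<in> (\<Union>D\<in>N. sgi H D)"
    then obtain D where D: "D \<in> N" "G \<in> sgi H D" by blast
    then show ?thesis
      using sgi_gnd_insts[OF wf[OF D(1)] D(2)] I(1) by (auto simp: is_model_def)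
  next
    assume G: "G \<in> GndTh H"
    then show ?thesis using GndTh[OF G] by (simp add: GndTh_def)
  qed
  have Red_F: "sat_gnd_cls I G" if G: "G \<in> Red_F H lt ?M" for G
  proof -
    obtain M' where M': "M' \<subseteq> ?M" "is_model ?S I M' \<longrightarrow> is_model ?S I {G}"
      using G unfolding Red_F_def by blast
    have "\<forall>C\<in>M'. \<forall>C'\<in>gnd_insts ?S C. sat_gnd_cls I C'"
    proof (intro ballI)
      fix C C' assume C: "C \<in> M'" "C' \<in> gnd_insts ?S C"
      then have "C \<in> ?M" using M'(1) by blast
      from M[OF this] show "sat_gnd_cls I C'" using C(2) gnd_insts_gnd[of C ?S] by simp
    qed
    then have "is_model ?S I {G}" using M'(2) interp by (simp add: is_model_def)
    moreover have "vars_cls G = {}" using G unfolding Red_F_def by blast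
    ultimately show ?thesis by (simp add: is_model_def gnd_insts_gnd)
  qed
  have "sgi H C \<subseteq> Red_F H lt ?M \<union> GndTh H" "wf_cls H C" using C unfolding Red_H_def by blast+
  then show ?thesis
    using valid_sgi[OF H interp I(2)] GndTh Red_F by blast
qed

text \<open>Most of the work is well-formedness of the two new clauses: redundancy refers to their
  simple ground instances, which are known to be sort-respecting instances only for well-formed
  clauses.\<close>

lemma define_entails_premises:
  fixes H :: "('f, 's, 'u) hspec"
  assumes H: "hierarchic_spec H" and rule: "define_rule H lt par N N'"
    and wf: "\<forall>C\<in>N. wf_cls H C"
    and I: "is_model (full_sig H) I N'" "reduct (bg_sig H) I \<in> bg_models H"
  shows "is_model (full_sig H) I N"
  using rule
proof cases
  case (1 P K c t u D t' a N0 E1 E2)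
  let ?S = "full_sig H"
  have interp: "interpretation_of ?S I" "term_generated ?S I" using I(1) by (auto simp: is_model_def)
  have P: "P \<in> N" using 1(1) by simp
  have wf_P: "wf_trm H (c\<langle>t\<rangle>)" "wf_trm H u" "trm_sort ?S (c\<langle>t\<rangle>) = trm_sort ?S u" "wf_cls H D"
    using wf P 1(3) wf_cls_add_Upair[OF 1(4)] by blast+
  note t = wf_trm_ctxt[OF wf_P(1)]
  obtain \<sigma> C' where \<sigma>: "unabstr_run P \<sigma> C'" "t' = t \<cdot> \<sigma>"
    using 1(8) by (auto simp: unabstracted_version_def is_unabstr_def)
  have "wf_subst H \<sigma>" using unabstr_run_wf[OF \<sigma>(1)] wf P by blast
  then have t': "wf_trm H t'" "trm_sort ?S t' = trm_sort ?S t" using wf_trm_subst t \<sigma>(2) by blast+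
  have a: "wf_trm H (Fun a [])"
    using 1(11) hierarchic_spec_sigs(3-5)[OF H] by (auto simp: wf_trm_def)
  have "wf_cls H {#t' \<approx> Fun a []#}"
    using t' a 1(12) by (simp add: wf_cls_add_Upair[of Pos]) (simp add: wf_cls_def)
  then have E1: "wf_cls H E1" by (rule wf_abstr[OF H 1(14)])
  have "wf_cls H (add_mset (K (Upair (c\<langle>Fun a []\<rangle>) u)) D)"
    using wf_trm_ctxt_replace[OF wf_P(1) a] wf_P t'(2) 1(12) unfolding wf_cls_add_Upair[OF 1(4)] by simp
  then have E2: "wf_cls H E2" by (rule wf_abstr[OF H 1(15)])
  have "\<And>D. D \<in> N' \<Longrightarrow> wf_cls H D" using E1 E2 wf 1(1,2) by blast
  then have "valid ?S I P" using Red_H_sound[OF H _ I] 1(2,16) by blast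
  then have "is_model ?S I {P}" by (intro valid_is_model[OF interp]) simp
  then show ?thesis using I(1) 1(1,2) by (auto simp: is_model_def)
qed

text \<open>The empty clause is its own only ground instance and is false, so entailing it means
  having no model over the background class.\<close>

lemma b_entails_empty_clause:
  fixes H :: "('f, 's, 'u) hspec"
  shows "b_entails H N {{#}} \<longleftrightarrow> (\<nexists>I. is_model (full_sig H) I N \<and> reduct (bg_sig H) I \<in> bg_models H)"
proof -
  have "\<not> is_model (full_sig H) I {{#}}" for I :: "('f, 's, 'u) interp"
    by (simp add: is_model_def gnd_insts_gnd vars_cls_def sat_gnd_cls_def)
  then show ?thesis by (auto simp: b_entails_def)
qed

theorem theorem7:
  fixes H :: "('f, 's, 'u) hspec"
    and lt :: "('f, 's) trm \<Rightarrow> ('f, 's) trm \<Rightarrow> bool"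
    and sel :: "('f, 's) clause \<Rightarrow> ('f, 's) clause"
    and par :: "('f, 's) trm \<Rightarrow> 'f"
    and N N' :: "('f, 's) clause set"
  assumes "hierarchic_spec H"
    and "hierarchic_reduction_ordering H lt"
    and "selection_function sel"
    and "\<forall>C\<in>N. wf_cls H C"
    and "hsp_inference H lt sel par N N'"
  shows "(b_entails H N {{#}} \<longleftrightarrow> b_entails H N' {{#}}) \<and> b_entails H N' N"
proof -
  let ?S = "full_sig H"
  note H = assms(1)
  \<comment> \<open>The directions are asymmetric because of Define: forwards the model may have to
    be replaced by some \<open>J\<close>, backwards the same \<open>I\<close> serves, which also
    gives the entailment of \<open>N\<close>.\<close>
  have "(\<forall>I. is_model ?S I N \<and> reduct (bg_sig H) I \<in> bg_models H \<longrightarrow>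
        (\<exists>J. is_model ?S J N' \<and> reduct (bg_sig H) J \<in> bg_models H)) \<and>
      (\<forall>I. is_model ?S I N' \<and> reduct (bg_sig H) I \<in> bg_models H \<longrightarrow> is_model ?S I N)"
    using assms(5) unfolding hsp_inference_def
  proof
    assume "\<exists>C. hsp_base H lt sel N C \<and> N' = N \<union> {C}"
    then obtain C where C: "hsp_base H lt sel N C" "N' = N \<union> {C}" by blast
    have "is_model ?S I N'" if I: "is_model ?S I N" "reduct (bg_sig H) I \<in> bg_models H" for I
    proof -
      have "is_model ?S I {C}" using hsp_base_sound[OF H _ I C(1)] assms(4) by blast
      then show ?thesis using I(1) unfolding C(2) is_model_def by blast
    qed
    moreover have "is_model ?S I N" if "is_model ?S I N'" for I :: "('f, 's, 'u) interp"
      using that C(2) by (auto simp: is_model_def)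
    ultimately show ?thesis by blast
  next
    assume rule: "define_rule H lt par N N'"
    show ?thesis
      using define_preserves_model[OF H rule assms(4)] define_entails_premises[OF H rule assms(4)]
      by blast
  qed
  then show ?thesis unfolding b_entails_empty_clause unfolding b_entails_def by blast
qed

end
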